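(* Let $\mathcal{A}=\{H_1,\ldots,H_l\}$ be a hyperplane arrangement in $\mathbb{C}\mathbb{P}^n$ with Orlik-Solomon algebra $A$, and let $1\le k\le n$. Let $V$ be a linear subspace of $A^1$, and let $M$ be a matrix whose rows are the coefficients of a generating system of $V$ in terms of the canonical basis $x_1,\ldots,x_l$ of $A^1$. Let $v_1,\ldots,v_l$ be the columns of $M$, and for each flat $S$ of the intersection lattice put $v_S:=\sum_{H_i\supseteq S}v_i$. Then $V$ is $k$-isotropic if and only if for every truncated flag $F=(S_k\supset\cdots\supset S_1)$ of length $k$ of flats with $\dim(S_i)=i+n-k$ for all $i$ (where $\dim$ denotes the dimension of the corresponding linear subspace of $\mathbb{C}^{n+1}$, so that $S_i$ has codimension $k-i+1$), the vectors $v_{S_k},\ldots,v_{S_1}$ span a space of dimension lower than $k$.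
   Context: Let $\mathcal{A}=\{H_1,\ldots,H_l\}$ be an arrangement of distinct hyperplanes in $\mathbb{C}\mathbb{P}^n$. Orlik-Solomon algebra: let $E$ be the exterior algebra of $A^1:=\mathbb{C}^l$ with canonical generators $x_1,\ldots,x_l$ (one for each hyperplane), and let $K$ be the ideal of $E$ generated by (i) the elements $\partial(x_{i_1}\wedge\cdots\wedge x_{i_m}):=\sum_{j=1}^m(-1)^j x_{i_1}\wedge\cdots\wedge x_{i_{j-1}}\wedge x_{i_{j+1}}\wedge\cdots\wedge x_{i_m}$ for all $H_{i_1},\ldots,H_{i_m}$ that intersect non-generically (i.e. with nonempty intersection of codimension less than $m$), and (ii) the monomials $x_{i_1}\wedge\cdots\wedge x_{i_m}$ with $H_{i_1}\cap\cdots\cap H_{i_m}=\emptyset$. The Orlik-Solomon algebra is $A=E/K$; it is graded, with homogeneous part of degree $i$ denoted $A^i$. A linear subspace $V\subseteq A^1$ is $k$-isotropic if the product in $A$ of any $k$ vectors of $V$ vanishes. A flat is a nonempty intersection of some hyperplanes of the arrangement; flags are strictly decreasing sequences of flats. *)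

theory Defs
  imports "HOL-Analysis.Cartesian_Space" "HOL-Algebra.QuotRing" Complex_Main
begin

section \<open>Projective space and hyperplane arrangements\<close>

text \<open>
  Points of \<open>\<complex>\<P>\<^sup>n\<close> are the lines through the origin in \<open>\<complex>\<^sup>n\<^sup>+\<^sup>1\<close>, which is modelled by
  \<^typ>\<open>complex ^ 'd\<close> with \<open>CARD('d) = n + 1\<close>.
\<close>

definition proj_points :: "(complex ^ 'd) set set" where
  "proj_points = {L. vec.subspace L \<and> vec.dim L = 1}"

definition projectivization :: "(complex ^ 'd) set \<Rightarrow> (complex ^ 'd) set set" where
  "projectivization U = {L \<in> proj_points. L \<subseteq> U}"

definition is_hyperplane :: "(complex ^ 'd) set set \<Rightarrow> bool" where
  "is_hyperplane S \<longleftrightarrow>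
     (\<exists>U. vec.subspace U \<and> vec.dim U + 1 = CARD('d) \<and> S = projectivization U)"

definition is_arrangement :: "('l \<Rightarrow> (complex ^ 'd) set set) \<Rightarrow> bool" where
  "is_arrangement H \<longleftrightarrow> (\<forall>i. is_hyperplane (H i)) \<and> inj H"

text \<open>
  Dimension of the linear subspace of \<open>\<complex>\<^sup>n\<^sup>+\<^sup>1\<close> corresponding to a projective subspace;
  it is one more than the projective dimension, and \<open>0\<close> for the empty set.
\<close>

definition lin_dim :: "(complex ^ 'd) set set \<Rightarrow> nat" where
  "lin_dim S = vec.dim (vec.span (\<Union>S))"

definition codim :: "(complex ^ 'd) set set \<Rightarrow> nat" where
  "codim S = CARD('d) - lin_dim S"

text \<open>
  Intersections are taken inside projective space, so the empty family gives
  \<^const>\<open>proj_points\<close>.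
\<close>

definition meet :: "('l \<Rightarrow> (complex ^ 'd) set set) \<Rightarrow> 'l set \<Rightarrow> (complex ^ 'd) set set" where
  "meet H I = {p \<in> proj_points. \<forall>i\<in>I. p \<in> H i}"

definition flats :: "('l \<Rightarrow> (complex ^ 'd) set set) \<Rightarrow> (complex ^ 'd) set set set" where
  "flats H = {meet H I | I. meet H I \<noteq> {}}"


section \<open>The exterior algebra of \<open>\<complex>\<^sup>l\<close>\<close>

text \<open>
  The exterior algebra on generators \<open>x\<^sub>i\<close>, \<open>i :: 'l\<close>, is modelled on its monomial basis:
  the coordinate at \<open>{i\<^sub>1 < \<dots> < i\<^sub>m}\<close> is the coefficient of \<open>x\<^sub>i\<^sub>1 \<and> \<dots> \<and> x\<^sub>i\<^sub>m\<close>. For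
  disjoint \<open>T\<close> and \<open>U\<close> the sign of the permutation sorting the elements of \<open>T\<close> followed by
  those of \<open>U\<close> is \<open>shuffle_sign T U\<close>.
\<close>

type_synonym 'l ext = "complex ^ ('l set)"

definition shuffle_sign :: "'l::{finite,linorder} set \<Rightarrow> 'l set \<Rightarrow> complex" where
  "shuffle_sign T U = (-1) ^ card {(t, u). t \<in> T \<and> u \<in> U \<and> u < t}"

definition wedge :: "'l::{finite,linorder} ext \<Rightarrow> 'l ext \<Rightarrow> 'l ext" where
  "wedge a b = (\<chi> S. \<Sum>T\<in>Pow S. shuffle_sign T (S - T) * a $ T * b $ (S - T))"

definition exterior_algebra :: "'l::{finite,linorder} ext ring" where
  "exterior_algebra =
     \<lparr>carrier = UNIV, mult = wedge, one = axis {} 1, zero = 0, add = (+)\<rparr>"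

definition ext_gen :: "'l::{finite,linorder} \<Rightarrow> 'l ext" where
  "ext_gen i = axis {i} 1"

definition ext_monomial :: "'l::{finite,linorder} list \<Rightarrow> 'l ext" where
  "ext_monomial is = foldr wedge (map ext_gen is) (axis {} 1)"

text \<open>The list is indexed from \<open>0\<close>, whence the sign \<open>(-1) ^ (j + 1)\<close>.\<close>

definition ext_boundary :: "'l::{finite,linorder} list \<Rightarrow> 'l ext" where
  "ext_boundary is =
     (\<Sum>j<length is. (-1) ^ (j + 1) *s ext_monomial (take j is @ drop (j + 1) is))"

definition ext_embed :: "complex ^ ('l::{finite,linorder}) \<Rightarrow> 'l ext" where
  "ext_embed v = (\<Sum>i\<in>UNIV. (v $ i) *s ext_gen i)"


section \<open>The Orlik--Solomon algebra\<close>

definition os_relations ::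
  "('l::{finite,linorder} \<Rightarrow> (complex ^ 'd) set set) \<Rightarrow> 'l ext set" where
  "os_relations H =
     {ext_boundary is | is. distinct is \<and> meet H (set is) \<noteq> {} \<and>
                            codim (meet H (set is)) < length is} \<union>
     {ext_monomial is | is. distinct is \<and> meet H (set is) = {}}"

definition os_ideal ::
  "('l::{finite,linorder} \<Rightarrow> (complex ^ 'd) set set) \<Rightarrow> 'l ext set" where
  "os_ideal H = genideal exterior_algebra (os_relations H)"

definition orlik_solomon ::
  "('l::{finite,linorder} \<Rightarrow> (complex ^ 'd) set set) \<Rightarrow> 'l ext set ring" where
  "orlik_solomon H = exterior_algebra Quot os_ideal H"

text \<open>The class in the Orlik--Solomon algebra of a vector of \<open>A\<^sup>1 = \<complex>\<^sup>l\<close>.\<close>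

definition os_class ::
  "('l::{finite,linorder} \<Rightarrow> (complex ^ 'd) set set) \<Rightarrow> complex ^ ('l::{finite,linorder}) \<Rightarrow> 'l ext set" where
  "os_class H v = a_r_coset exterior_algebra (os_ideal H) (ext_embed v)"

definition isotropic ::
  "('l::{finite,linorder} \<Rightarrow> (complex ^ 'd) set set) \<Rightarrow> nat \<Rightarrow> (complex ^ ('l::{finite,linorder})) set \<Rightarrow> bool" where
  "isotropic H k V \<longleftrightarrow>
     (\<forall>vs. length vs = k \<and> set vs \<subseteq> V \<longrightarrow>
        foldr (mult (orlik_solomon H)) (map (os_class H) vs) (one (orlik_solomon H))
          = zero (orlik_solomon H))"


section \<open>Truncated flags and the vectors \<open>v\<^sub>S\<close>\<close>

text \<open>
  \<open>S k \<supset> \<dots> \<supset> S 1\<close>; only the values \<open>S 1, \<dots>, S k\<close> matter. The dimension condition is meant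
  for \<open>k \<le> n\<close>, so that the subtraction below is exact.
\<close>

definition truncated_flag ::
  "('l \<Rightarrow> (complex ^ 'd) set set) \<Rightarrow> nat \<Rightarrow> nat \<Rightarrow> (nat \<Rightarrow> (complex ^ 'd) set set) \<Rightarrow> bool" where
  "truncated_flag H n k S \<longleftrightarrow>
     (\<forall>i\<in>{1..k}. S i \<in> flats H) \<and>
     (\<forall>i\<in>{1..<k}. S i \<subset> S (i + 1)) \<and>
     (\<forall>i\<in>{1..k}. lin_dim (S i) = i + n - k)"

definition flat_vector ::
  "('l \<Rightarrow> (complex ^ 'd) set set) \<Rightarrow> complex ^ 'l ^ 'r \<Rightarrow> (complex ^ 'd) set set
     \<Rightarrow> complex ^ 'r" where
  "flat_vector H M S = (\<Sum>i\<in>{i. S \<subseteq> H i}. column i M)"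


section \<open>The ring laws\<close>

lemma shuffle_sign_Un_left:
  assumes "P \<inter> Q = {}"
  shows "shuffle_sign (P \<union> Q) R = shuffle_sign P R * shuffle_sign Q R"
proof -
  let ?f = "\<lambda>T. {(t, u). t \<in> T \<and> u \<in> R \<and> u < t}"
  have "?f (P \<union> Q) = ?f P \<union> ?f Q" by auto
  moreover have "card (?f P \<union> ?f Q) = card (?f P) + card (?f Q)"
    using assms by (intro card_Un_disjoint) auto
  ultimately show ?thesis by (simp add: shuffle_sign_def power_add)
qed

lemma shuffle_sign_Un_right:
  assumes "Q \<inter> R = {}"
  shows "shuffle_sign P (Q \<union> R) = shuffle_sign P Q * shuffle_sign P R"
proof -
  let ?f = "\<lambda>U. {(t, u). t \<in> P \<and> u \<in> U \<and> u < t}"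
  have "?f (Q \<union> R) = ?f Q \<union> ?f R" by auto
  moreover have "card (?f Q \<union> ?f R) = card (?f Q) + card (?f R)"
    using assms by (intro card_Un_disjoint) auto
  ultimately show ?thesis by (simp add: shuffle_sign_def power_add)
qed

lemma shuffle_sign_empty [simp]: "shuffle_sign {} U = 1" "shuffle_sign T {} = 1"
  by (simp_all add: shuffle_sign_def)

lemma wedge_assoc: "wedge (wedge a b) c = wedge a (wedge b c)"
proof -
  have "wedge (wedge a b) c $ S = wedge a (wedge b c) $ S" for S
  proof -
    have "wedge (wedge a b) c $ S =
      (\<Sum>T\<in>Pow S. \<Sum>P\<in>Pow T. shuffle_sign T (S - T) * shuffle_sign P (T - P) *
         a $ P * b $ (T - P) * c $ (S - T))"
      by (simp add: wedge_def sum_distrib_left sum_distrib_right mult_ac)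
    also have "\<dots> = (\<Sum>(T, P)\<in>Sigma (Pow S) Pow. shuffle_sign T (S - T) *
         shuffle_sign P (T - P) * a $ P * b $ (T - P) * c $ (S - T))"
      by (rule sum.Sigma) auto
    also have "\<dots> = (\<Sum>(P, Q)\<in>Sigma (Pow S) (\<lambda>P. Pow (S - P)). shuffle_sign P (S - P) *
         shuffle_sign Q (S - P - Q) * a $ P * b $ Q * c $ (S - P - Q))"
    proof (rule sum.reindex_bij_witness
        [where i = "\<lambda>(P, Q). (P \<union> Q, P)" and j = "\<lambda>(T, P). (P, T - P)"], goal_cases)
      case (5 x)
      then obtain T P where x: "x = (T, P)" and sub: "T \<subseteq> S" "P \<subseteq> T" by auto
      have "shuffle_sign T (S - T) = shuffle_sign P (S - T) * shuffle_sign (T - P) (S - T)"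
        using shuffle_sign_Un_left[of P "T - P" "S - T"] sub by (simp add: Un_absorb1)
      moreover have "shuffle_sign P (S - P) = shuffle_sign P (T - P) * shuffle_sign P (S - T)"
      proof -
        have "S - P = (T - P) \<union> (S - T)" using sub by auto
        then show ?thesis using shuffle_sign_Un_right[of "T - P" "S - T" P] by auto
      qed
      moreover have "S - P - (T - P) = S - T" using sub by auto
      ultimately show ?case by (simp add: x mult_ac)
    qed auto
    also have "\<dots> = (\<Sum>P\<in>Pow S. \<Sum>Q\<in>Pow (S - P). shuffle_sign P (S - P) *
         shuffle_sign Q (S - P - Q) * a $ P * b $ Q * c $ (S - P - Q))"
      by (rule sum.Sigma[symmetric]) auto
    also have "\<dots> = wedge a (wedge b c) $ S"
      by (simp add: wedge_def sum_distrib_left sum_distrib_right mult_ac)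
    finally show ?thesis .
  qed
  then show ?thesis by (simp add: vec_eq_iff)
qed

lemma wedge_one_left: "wedge (axis {} 1) a = a"
proof -
  have "wedge (axis {} 1) a $ S = a $ S" for S
  proof -
    have "wedge (axis {} 1) a $ S = (\<Sum>T\<in>Pow S. if T = {} then a $ S else 0)"
      unfolding wedge_def vec_lambda_beta by (rule sum.cong) (auto simp: axis_def)
    then show ?thesis by simp
  qed
  then show ?thesis by (simp add: vec_eq_iff)
qed

lemma wedge_one_right: "wedge a (axis {} 1) = a"
proof -
  have "wedge a (axis {} 1) $ S = a $ S" for S
  proof -
    have "wedge a (axis {} 1) $ S = (\<Sum>T\<in>Pow S. if T = S then a $ S else 0)"
      unfolding wedge_def vec_lambda_beta by (rule sum.cong) (auto simp: axis_def)
    then show ?thesis by simp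
  qed
  then show ?thesis by (simp add: vec_eq_iff)
qed

lemma wedge_add_left: "wedge (a + b) c = wedge a c + wedge b c"
  by (simp add: wedge_def vec_eq_iff sum.distrib algebra_simps)

lemma wedge_add_right: "wedge a (b + c) = wedge a b + wedge a c"
  by (simp add: wedge_def vec_eq_iff sum.distrib algebra_simps)

lemma wedge_scale_left: "wedge (c *s a) b = c *s wedge a b"
  by (simp add: wedge_def vec_eq_iff sum_distrib_left mult_ac)

lemma wedge_scale_right: "wedge a (c *s b) = c *s wedge a b"
  by (simp add: wedge_def vec_eq_iff sum_distrib_left mult_ac)

lemma ring_exterior_algebra: "ring (exterior_algebra :: 'l::{finite,linorder} ext ring)"
proof (rule ringI)
  show "abelian_group (exterior_algebra :: 'l ext ring)"
  proof (rule abelian_groupI)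
    fix x :: "'l ext"
    show "\<exists>y\<in>carrier exterior_algebra. y \<oplus>\<^bsub>exterior_algebra\<^esub> x = \<zero>\<^bsub>exterior_algebra\<^esub>"
      by (rule bexI[of _ "- x"]) (auto simp: exterior_algebra_def)
  qed (auto simp: exterior_algebra_def algebra_simps)
  show "Group.monoid (exterior_algebra :: 'l ext ring)"
    by (rule Group.monoidI)
      (auto simp: exterior_algebra_def wedge_assoc wedge_one_left wedge_one_right)
qed (auto simp: exterior_algebra_def wedge_add_left wedge_add_right)

lemma wedge_ext_gen_self: "wedge (ext_gen i) (ext_gen i) = 0"
  unfolding wedge_def ext_gen_def vec_eq_iff
  by (auto simp: axis_def intro!: sum.neutral)

lemma wedge_ext_gen_anticommute:
  "wedge (ext_gen i) (ext_gen j) = - wedge (ext_gen j) (ext_gen i)"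
proof (cases "i = j")
  case False
  have key: "wedge (ext_gen i) (ext_gen j) = axis {i, j} (shuffle_sign {i} {j})"
    if "i \<noteq> j" for i j :: 'a
  proof -
    have "wedge (ext_gen i) (ext_gen j) $ S = axis {i, j} (shuffle_sign {i} {j}) $ S" for S
    proof -
      have "wedge (ext_gen i) (ext_gen j) $ S =
        (\<Sum>T\<in>Pow S. if T = {i} then (if S = {i, j} then shuffle_sign {i} {j} else 0) else 0)"
        unfolding wedge_def vec_lambda_beta
      proof (rule sum.cong)
        fix T assume "T \<in> Pow S"
        then have "T = {i} \<and> S - T = {j} \<longleftrightarrow> T = {i} \<and> S = {i, j}"
          using that by blast
        then show "shuffle_sign T (S - T) * ext_gen i $ T * ext_gen j $ (S - T) =
            (if T = {i} then (if S = {i, j} then shuffle_sign {i} {j} else 0) else 0)"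
          by (cases "T = {i}"; cases "S = {i, j}") (auto simp: ext_gen_def axis_def)
      qed simp
      also have "\<dots> = (if S = {i, j} then shuffle_sign {i} {j} else 0)"
        by simp
      finally show ?thesis by (simp add: axis_def)
    qed
    then show ?thesis by (simp add: vec_eq_iff)
  qed
  have sgn: "shuffle_sign {i} {j} = (if j < i then -1 else 1)" for i j :: 'a
  proof -
    have "{(t, u). t \<in> {i} \<and> u \<in> {j} \<and> u < t} = (if j < i then {(i, j)} else {})" by auto
    then show ?thesis by (simp add: shuffle_sign_def)
  qed
  have "shuffle_sign {i} {j} = - shuffle_sign {j} {i}"
    using False by (auto simp: sgn)
  then show ?thesis
    using key[OF False] key[of j i] False by (simp add: insert_commute axis_def vec_eq_iff)
qed (simp add: wedge_ext_gen_self)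

end

theory Submission
  imports Defs
begin

text \<open>
  The proof pairs the Orlik--Solomon algebra with flags. For a flat \<open>S\<close> consider the linear form
  \<open>\<phi>\<^sub>S\<close> on \<open>A\<^sup>1\<close> with \<open>\<phi>\<^sub>S(x\<^sub>i) = 1\<close> if \<open>H\<^sub>i \<supseteq> S\<close> and \<open>\<phi>\<^sub>S(x\<^sub>i) = 0\<close> otherwise. A truncated flag \<open>F\<close>
  of length \<open>k\<close> defines a functional on the exterior algebra: contract with the forms of its \<open>k\<close>
  members and take the constant term. On products it is a determinant,
  \<open>\<alpha>\<^sub>1 \<and> \<dots> \<and> \<alpha>\<^sub>k \<mapsto> \<plusminus>det (\<phi>\<^bsub>S\<^sub>q\<^esub>(\<alpha>\<^sub>p))\<close>. For \<open>k \<le> n\<close>, an element of degree \<open>k\<close> lies in the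
  Orlik--Solomon ideal if and only if all these flag functionals vanish on it.

  That they vanish on the ideal (\<open>flag_functional_os_ideal\<close>) comes from one observation. Assign to a
  hyperplane its level, the index of the largest member of the flag that it contains. Hyperplanes
  of pairwise different levels meet generically (\<open>codim_of_distinct_levels\<close>). A non-generic family
  therefore has two members \<open>i\<close>, \<open>j\<close> of the same level; the boundary of its monomial is divisible
  by \<open>x\<^sub>i - x\<^sub>j\<close>, and every form of the flag kills \<open>x\<^sub>i - x\<^sub>j\<close>. Families with empty intersection
  have more than \<open>n\<close> members and do not matter in degree \<open>k\<close>.

  The converse (\<open>mem_os_ideal_if_flag_functionals_vanish\<close>) uses sets without broken circuits. Their
  monomials span degree \<open>k\<close> modulo the ideal (\<open>nbc_reducible_axis\<close>). Attach to
  \<open>I = {i\<^sub>1 < \<dots> < i\<^sub>k}\<close> the flag with members \<open>H\<^sub>i\<^sub>p \<inter> \<dots> \<inter> H\<^sub>i\<^sub>k\<close>; then \<open>i\<^sub>p\<close> is the least hyperplane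
  containing the \<open>p\<close>-th member, and this makes the functionals of these flags dual, up to sign, to
  the monomials (\<open>flag_functional_nbc_axis\<close>). So all coefficients of such a combination can be read
  off from the values of the functionals.

  It remains to evaluate the functional of a flag on products of vectors of \<open>V\<close>. If \<open>\<alpha>\<close> is the
  combination of the rows of \<open>M\<close> with coefficients \<open>c\<close>, then \<open>\<phi>\<^sub>S(\<alpha>)\<close> is the scalar product of \<open>c\<close>
  with \<open>v\<^sub>S\<close>. Hence the functional vanishes on all products when the vectors \<open>v\<^sub>S\<close> of the
  flag are dependent (\<open>flag_functional_product_dependent\<close>), and when they are independent it takes the
  value \<open>1\<close> on the product of a dual family of vectors of \<open>V\<close>
  (\<open>iterated_contraction_dual_product\<close>).
\<close>

section \<open>Multiplication by a generator\<close>

lemma shuffle_sign_singleton: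
  "shuffle_sign {i} S = (-1) ^ card {u \<in> S. u < i}"
proof -
  have "{(t, u). t \<in> {i} \<and> u \<in> S \<and> u < t} = Pair i ` {u \<in> S. u < i}" by auto
  then show ?thesis
    by (simp add: shuffle_sign_def card_image inj_on_def)
qed

lemma shuffle_sign_singleton_insert:
  fixes i j :: "'l::{finite,linorder}"
  assumes "j \<notin> S"
  shows "shuffle_sign {i} (insert j S) = (if j < i then -1 else 1) * shuffle_sign {i} S"
proof -
  have "{u \<in> insert j S. u < i} = (if j < i then insert j {u \<in> S. u < i} else {u \<in> S. u < i})"
    by auto
  then show ?thesis using assms by (simp add: shuffle_sign_singleton)
qed

lemma shuffle_sign_singleton_self: "shuffle_sign {i} (S - {i}) = shuffle_sign {i} S"
  unfolding shuffle_sign_singleton by (rule arg_cong[where f = "\<lambda>A. (-1) ^ card A"]) auto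

lemma shuffle_sign_square [simp]: "shuffle_sign T U * shuffle_sign T U = 1"
  by (simp add: shuffle_sign_def power_mult_distrib[symmetric])

lemma shuffle_sign_cases: "shuffle_sign T U = 1 \<or> shuffle_sign T U = -1"
  by (cases "even (card {(t, u). t \<in> T \<and> u \<in> U \<and> u < t})") (simp_all add: shuffle_sign_def)

text \<open>
  Multiplication by a single generator has an explicit form in coordinates, with one term per
  coordinate. All later computations reduce to this one, because monomials and products of
  vectors of \<open>A\<^sup>1\<close> are built from it one factor at a time.
\<close>

lemma wedge_ext_gen_nth:
  "wedge (ext_gen i) y $ S = (if i \<in> S then shuffle_sign {i} S * y $ (S - {i}) else 0)"
proof -
  have "wedge (ext_gen i) y $ S =
      (\<Sum>T\<in>Pow S. if T = {i} then shuffle_sign {i} (S - {i}) * y $ (S - {i}) else 0)"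
    unfolding wedge_def vec_lambda_beta by (rule sum.cong) (auto simp: ext_gen_def axis_def)
  then show ?thesis by (simp add: shuffle_sign_singleton_self)
qed

lemma wedge_zero_left [simp]: "wedge 0 b = 0"
  and wedge_zero_right [simp]: "wedge a 0 = 0"
  by (simp_all add: wedge_def vec_eq_iff)

lemma wedge_minus_left: "wedge (- a) b = - wedge a b"
  and wedge_minus_right: "wedge a (- b) = - wedge a b"
  by (simp_all add: wedge_def vec_eq_iff sum_negf)

lemma wedge_diff_left: "wedge (a - b) c = wedge a c - wedge b c"
  and wedge_diff_right: "wedge a (b - c) = wedge a b - wedge a c"
  by (simp_all add: wedge_def vec_eq_iff sum_subtractf left_diff_distrib right_diff_distrib)

lemma wedge_sum_left: "wedge (\<Sum>i\<in>I. f i) b = (\<Sum>i\<in>I. wedge (f i) b)"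
  by (induction I rule: infinite_finite_induct) (simp_all add: wedge_add_left)

lemma wedge_sum_right: "wedge a (\<Sum>i\<in>I. f i) = (\<Sum>i\<in>I. wedge a (f i))"
  by (induction I rule: infinite_finite_induct) (simp_all add: wedge_add_right)

lemma ext_embed_axis: "ext_embed (axis i 1) = ext_gen i"
proof -
  have "ext_embed (axis i 1) = (\<Sum>j\<in>UNIV. if j = i then ext_gen i else 0)"
    unfolding ext_embed_def by (rule sum.cong) (auto simp: axis_def)
  then show ?thesis by simp
qed

lemma ext_embed_diff: "ext_embed (u - v) = ext_embed u - ext_embed v"
  by (simp add: ext_embed_def sum_subtractf vector_sub_rdistrib)

definition grade_involution :: "'l::{finite,linorder} ext \<Rightarrow> 'l ext" where
  "grade_involution a = (\<chi> S. (-1) ^ card S * a $ S)"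

text \<open>
  The grade involution is what is needed to move a vector of \<open>A\<^sup>1\<close> from the right of an
  arbitrary element to its left. A product \<open>a \<and> v \<and> b\<close> can thus be rewritten with \<open>v\<close> in
  front, where contractions act on it directly.
\<close>

lemma wedge_ext_gen_right: "wedge a (ext_gen i) = wedge (ext_gen i) (grade_involution a)"
proof -
  have "wedge a (ext_gen i) $ S = wedge (ext_gen i) (grade_involution a) $ S" for S
  proof -
    have "wedge a (ext_gen i) $ S =
        (\<Sum>T\<in>Pow S. if T = S - {i} then (if i \<in> S then shuffle_sign (S - {i}) {i} * a $ (S - {i}) else 0) else 0)"
      unfolding wedge_def vec_lambda_beta
    proof (rule sum.cong)
      fix T assume T: "T \<in> Pow S"
      show "shuffle_sign T (S - T) * a $ T * ext_gen i $ (S - T) =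
         (if T = S - {i} then (if i \<in> S then shuffle_sign (S - {i}) {i} * a $ (S - {i}) else 0) else 0)"
      proof (cases "S - T = {i}")
        case True
        then have "T = S - {i}" "i \<in> S" using T by auto
        with True show ?thesis by (simp add: ext_gen_def double_diff)
      next
        case False
        then have n: "T = S - {i} \<longrightarrow> i \<notin> S" by auto
        have "ext_gen i $ (S - T) = 0" using False by (simp only: ext_gen_def axis_def vec_lambda_beta if_False)
        moreover have "(if T = S - {i} then (if i \<in> S then c else 0) else 0) = (0 :: complex)" for c
          using n by presburger
        ultimately show ?thesis by (simp only: mult_zero_right)
      qed
    qed simp
    also have "\<dots> = (if i \<in> S then shuffle_sign (S - {i}) {i} * a $ (S - {i}) else 0)" by simp
    also have "\<dots> = wedge (ext_gen i) (grade_involution a) $ S"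
    proof (cases "i \<in> S")
      case True
      have "{(t, u). t \<in> S - {i} \<and> u \<in> {i} \<and> u < t} = (\<lambda>t. (t, i)) ` {t \<in> S. i < t}" by auto
      then have s: "shuffle_sign (S - {i}) {i} = (-1) ^ card {t \<in> S. i < t}"
        by (simp add: shuffle_sign_def card_image inj_on_def)
      have split: "S - {i} = {u \<in> S. u < i} \<union> {t \<in> S. i < t}" by auto
      have "card (S - {i}) = card {u \<in> S. u < i} + card {t \<in> S. i < t}"
        unfolding split by (rule card_Un_disjoint) auto
      then have "(-1 :: complex) ^ card {u \<in> S. u < i} * (-1) ^ card (S - {i}) = (-1) ^ card {t \<in> S. i < t}"
        by (simp add: power_add mult.assoc[symmetric] power_mult_distrib[symmetric])
      then show ?thesis using True
        by (simp add: wedge_ext_gen_nth grade_involution_def shuffle_sign_singleton s mult.assoc[symmetric])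
    qed (simp add: wedge_ext_gen_nth)
    finally show ?thesis .
  qed
  then show ?thesis by (simp add: vec_eq_iff)
qed

lemma wedge_ext_embed_right:
  "wedge a (ext_embed v) = wedge (ext_embed v) (grade_involution a)"
  by (simp add: ext_embed_def wedge_sum_left wedge_sum_right wedge_scale_left wedge_scale_right
      wedge_ext_gen_right)

lemma wedge_ext_gen_axis:
  "wedge (ext_gen i) (axis S 1) = (if i \<in> S then 0 else shuffle_sign {i} S *s axis (insert i S) 1)"
proof -
  have "wedge (ext_gen i) (axis S 1) $ T =
      (if i \<in> S then 0 else shuffle_sign {i} S *s axis (insert i S) 1) $ T" for T
  proof (cases "i \<in> T \<and> T - {i} = S")
    case True
    then have "T = insert i S" "i \<notin> S" by auto
    moreover have "shuffle_sign {i} T = shuffle_sign {i} S"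
      using shuffle_sign_singleton_self[of i T] True by simp
    ultimately show ?thesis by (simp add: wedge_ext_gen_nth)
  next
    case False
    then have "i \<in> S \<or> T \<noteq> insert i S" by auto
    with False show ?thesis by (auto simp: wedge_ext_gen_nth axis_def)
  qed
  then show ?thesis by (simp add: vec_eq_iff)
qed

lemma ext_monomial_Nil: "ext_monomial [] = axis {} 1"
  and ext_monomial_Cons: "ext_monomial (i # is) = wedge (ext_gen i) (ext_monomial is)"
  by (simp_all add: ext_monomial_def)

lemma ext_monomial_append: "ext_monomial (xs @ ys) = wedge (ext_monomial xs) (ext_monomial ys)"
  by (induction xs) (simp_all add: ext_monomial_Nil ext_monomial_Cons wedge_one_left wedge_assoc)

text \<open>
  Reordering the factors of a monomial only changes its sign, so up to sign a monomial depends on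
  its index set alone. This lets each argument choose the ordering that suits it.
\<close>

lemma ext_monomial_distinct:
  assumes "distinct is"
  obtains c where "c = 1 \<or> c = -1" "ext_monomial is = c *s axis (set is) 1"
  using assms
proof (induction "is" arbitrary: thesis)
  case Nil
  then show ?case by (metis ext_monomial_Nil list.set(1) vector_smult_lid)
next
  case (Cons i "is")
  obtain c where c: "c = 1 \<or> c = -1" "ext_monomial is = c *s axis (set is) 1"
    using Cons.IH Cons.prems(2) by auto
  have "ext_monomial (i # is) = (c * shuffle_sign {i} (set is)) *s axis (set (i # is)) 1"
    using Cons.prems(2) by (simp add: ext_monomial_Cons c(2) wedge_scale_right wedge_ext_gen_axis vector_smult_assoc)
  moreover have "c * shuffle_sign {i} (set is) = 1 \<or> c * shuffle_sign {i} (set is) = -1"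
    using c(1) shuffle_sign_cases[of "{i}" "set is"] by auto
  ultimately show ?case by (rule Cons.prems(1)[rotated])
qed

lemma axis_eq_ext_monomial:
  assumes "distinct is"
  obtains c where "c = 1 \<or> c = -1" "axis (set is) 1 = c *s ext_monomial is"
proof -
  obtain c where c: "c = 1 \<or> c = -1" "ext_monomial is = c *s axis (set is) 1"
    using ext_monomial_distinct[OF assms] .
  then have "axis (set is) 1 = c *s ext_monomial is" by (auto simp: vector_smult_assoc)
  with c(1) show ?thesis by (rule that)
qed

lemma ext_eq_sum_axis: "(y :: 'l::{finite,linorder} ext) = (\<Sum>S\<in>UNIV. y $ S *s axis S 1)"
  by (simp add: basis_expansion)

section \<open>Contractions\<close>

text \<open>
  This is the interior product \<open>\<iota>\<^sub>f\<close> with the linear form that takes the value \<open>f i\<close> at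
  \<open>x\<^sub>i\<close>; it is the antiderivation of degree \<open>-1\<close> that extends this form. The coordinate formula
  is the transpose of left multiplication by \<open>\<Sum>\<^sub>i f i *s x\<^sub>i\<close>.
\<close>

definition contract :: "('l \<Rightarrow> complex) \<Rightarrow> 'l::{finite,linorder} ext \<Rightarrow> 'l ext" where
  "contract f y = (\<chi> S. \<Sum>i\<in>-S. f i * shuffle_sign {i} S * y $ insert i S)"

definition pairing :: "('l::finite \<Rightarrow> complex) \<Rightarrow> complex ^ 'l \<Rightarrow> complex" where
  "pairing f v = (\<Sum>i\<in>UNIV. f i * v $ i)"

lemma contract_add: "contract f (x + y) = contract f x + contract f y"
  and contract_scale: "contract f (c *s x) = c *s contract f x"
  and contract_add_fun: "contract (\<lambda>i. f i + g i) x = contract f x + contract g x"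
  and contract_scale_fun: "contract (\<lambda>i. c * f i) x = c *s contract f x"
  by (simp_all add: contract_def vec_eq_iff algebra_simps sum.distrib sum_distrib_left)

lemma contract_zero [simp]: "contract f 0 = 0"
  by (simp add: contract_def vec_eq_iff)

lemma contract_minus: "contract f (- x) = - contract f x"
  by (simp add: contract_def vec_eq_iff sum_negf)

lemma contract_diff: "contract f (x - y) = contract f x - contract f y"
  by (simp add: contract_def vec_eq_iff algebra_simps sum_subtractf)

lemma contract_sum: "contract f (\<Sum>i\<in>I. g i) = (\<Sum>i\<in>I. contract f (g i))"
  by (induction I rule: infinite_finite_induct) (simp_all add: contract_add)

lemma contract_one [simp]: "contract f (axis {} 1) = 0"
  by (simp add: contract_def vec_eq_iff axis_def)

text \<open>
  The antiderivation rule. In the sum that defines the contraction, the index \<open>i\<close> itself gives the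
  term \<open>f i *s y\<close>; every other index gives a term of \<open>x\<^sub>i \<and> \<iota>\<^sub>f y\<close>, and there the signs of
  inserting \<open>i\<close> and \<open>j\<close> in the two possible orders are opposite.
\<close>

lemma contract_wedge_ext_gen:
  "contract f (wedge (ext_gen i) y) = f i *s y - wedge (ext_gen i) (contract f y)"
proof -
  have "contract f (wedge (ext_gen i) y) $ S = (f i *s y - wedge (ext_gen i) (contract f y)) $ S" for S
  proof (cases "i \<in> S")
    case False
    have "contract f (wedge (ext_gen i) y) $ S =
        (\<Sum>j\<in>-S. if j = i then f i * y $ S else 0)"
      unfolding contract_def vec_lambda_beta wedge_ext_gen_nth
    proof (rule sum.cong)
      fix j assume "j \<in> - S"
      then show "f j * shuffle_sign {j} S * (if i \<in> insert j S
            then shuffle_sign {i} (insert j S) * y $ (insert j S - {i}) else 0) =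
          (if j = i then f i * y $ S else 0)"
        using False by (auto simp: shuffle_sign_singleton_insert mult.assoc)
    qed simp
    then show ?thesis using False by (simp add: wedge_ext_gen_nth)
  next
    case True
    have sg: "shuffle_sign {i} S * shuffle_sign {j} (S - {i}) = - shuffle_sign {j} S * shuffle_sign {i} (insert j S)"
      if "j \<notin> S" for j
    proof -
      have "insert i (S - {i}) = S" using True by auto
      then have s: "shuffle_sign {j} S = (if i < j then -1 else 1) * shuffle_sign {j} (S - {i})"
        using shuffle_sign_singleton_insert[of i "S - {i}" j] by simp
      have "i < j \<or> j < i" using True that by (metis linorder_neqE)
      then show ?thesis
        unfolding s shuffle_sign_singleton_insert[OF that, of i] by (elim disjE) (simp_all add: order_less_not_sym)
    qed
    have "- (S - {i}) = insert i (- S)" using True by auto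
    then have "(f i *s y - wedge (ext_gen i) (contract f y)) $ S =
       f i * y $ S - shuffle_sign {i} S * (f i * shuffle_sign {i} (S - {i}) * y $ S +
        (\<Sum>j\<in>-S. f j * shuffle_sign {j} (S - {i}) * y $ insert j (S - {i})))"
      using True by (simp add: wedge_ext_gen_nth contract_def insert_absorb)
    also have "\<dots> = - (\<Sum>j\<in>-S. f j * (shuffle_sign {i} S * shuffle_sign {j} (S - {i})) * y $ insert j (S - {i}))"
    proof -
      have "shuffle_sign {i} S * (f i * shuffle_sign {i} (S - {i}) * y $ S)
         = (shuffle_sign {i} S * shuffle_sign {i} S) * (f i * y $ S)"
        unfolding shuffle_sign_singleton_self by (simp only: mult_ac)
      then have "shuffle_sign {i} S * (f i * shuffle_sign {i} (S - {i}) * y $ S) = f i * y $ S"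
        by (simp only: shuffle_sign_square mult_1_left)
      moreover have "shuffle_sign {i} S *
          (\<Sum>j\<in>-S. f j * shuffle_sign {j} (S - {i}) * y $ insert j (S - {i})) =
          (\<Sum>j\<in>-S. f j * (shuffle_sign {i} S * shuffle_sign {j} (S - {i})) * y $ insert j (S - {i}))"
        by (simp only: sum_distrib_left mult_ac)
      ultimately show ?thesis by (simp only: distrib_left diff_add_eq_diff_diff_swap) simp
    qed
    also have "\<dots> = (\<Sum>j\<in>-S. f j * (shuffle_sign {j} S * shuffle_sign {i} (insert j S)) * y $ insert j (S - {i}))"
      unfolding sum_negf[symmetric] by (rule sum.cong) (auto simp: sg)
    also have "\<dots> = contract f (wedge (ext_gen i) y) $ S"
      unfolding contract_def vec_lambda_beta wedge_ext_gen_nth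
    proof (rule sum.cong)
      fix j assume "j \<in> - S"
      then have "insert j (S - {i}) = insert j S - {i}" using True by auto
      then show "f j * (shuffle_sign {j} S * shuffle_sign {i} (insert j S)) * y $ insert j (S - {i}) =
         f j * shuffle_sign {j} S * (if i \<in> insert j S
            then shuffle_sign {i} (insert j S) * y $ (insert j S - {i}) else 0)"
        using True by (simp add: mult_ac)
    qed simp
    finally show ?thesis by simp
  qed
  then show ?thesis by (simp add: vec_eq_iff)
qed

lemma contract_wedge_ext_embed:
  "contract f (wedge (ext_embed v) y) = pairing f v *s y - wedge (ext_embed v) (contract f y)"
proof -
  have "contract f (wedge (ext_embed v) y) =
      (\<Sum>i\<in>UNIV. v $ i *s (f i *s y - wedge (ext_gen i) (contract f y)))"
    by (simp add: ext_embed_def wedge_sum_left wedge_scale_left contract_sum contract_scale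
        contract_wedge_ext_gen)
  also have "\<dots> = (\<Sum>i\<in>UNIV. (f i * v $ i) *s y) - wedge (ext_embed v) (contract f y)"
    by (simp add: ext_embed_def wedge_sum_left wedge_scale_left vec_eq_iff sum_subtractf algebra_simps)
  also have "(\<Sum>i\<in>UNIV. (f i * v $ i) *s y) = pairing f v *s y"
    by (simp add: pairing_def vec_eq_iff sum_distrib_right)
  finally show ?thesis .
qed

text \<open>
  By the antiderivation rule the square of a contraction commutes with multiplication by every
  generator, and it kills \<open>1\<close>. So it kills all monomials. Polarizing yields anticommutation.
\<close>

lemma contract_contract_self: "contract f (contract f y) = 0"
proof -
  have mon: "contract f (contract f (ext_monomial xs)) = 0" for xs
    by (induction xs)
      (simp_all add: ext_monomial_Nil ext_monomial_Cons contract_wedge_ext_gen contract_diff contract_scale)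
  have ax: "contract f (contract f (axis S 1)) = 0" for S
  proof -
    obtain c where "axis S 1 = c *s ext_monomial (sorted_list_of_set S)"
      using axis_eq_ext_monomial[of "sorted_list_of_set S"] by auto
    then show ?thesis by (simp add: contract_scale mon)
  qed
  show ?thesis
    by (subst ext_eq_sum_axis[of y]) (simp add: contract_sum contract_scale ax)
qed

lemma contract_anticommute: "contract f (contract g y) = - contract g (contract f y)"
  using contract_contract_self[of "\<lambda>i. f i + g i" y]
  by (simp add: contract_add_fun contract_add contract_contract_self eq_neg_iff_add_eq_0 add.commute)

lemma contract_ext_monomial:
  "contract f (ext_monomial xs) =
     (\<Sum>j<length xs. ((-1) ^ j * f (xs ! j)) *s ext_monomial (take j xs @ drop (Suc j) xs))"
proof (induction xs)
  case (Cons x xs)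
  show ?case
    unfolding ext_monomial_Cons contract_wedge_ext_gen Cons
    by (simp add: sum.lessThan_Suc_shift wedge_sum_right wedge_scale_right ext_monomial_Cons
        flip: sum_negf del: sum.lessThan_Suc)
qed (simp add: ext_monomial_Nil)

text \<open>
  This makes the antiderivation rule available for the Orlik--Solomon relations.
\<close>

lemma ext_boundary_eq_contract: "ext_boundary xs = - contract (\<lambda>_. 1) (ext_monomial xs)"
  by (simp add: ext_boundary_def contract_ext_monomial flip: sum_negf)

text \<open>
  Bring the factors \<open>x\<^sub>i \<and> x\<^sub>j\<close> to the front and write the monomial as
  \<open>x\<^sub>i \<and> x\<^sub>j \<and> m\<close>. Its contraction is \<open>x\<^sub>j \<and> m - x\<^sub>i \<and> m + x\<^sub>i \<and> x\<^sub>j \<and> \<iota> m\<close>, and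
  \<open>x\<^sub>i \<and> x\<^sub>j = (x\<^sub>i - x\<^sub>j) \<and> x\<^sub>j\<close>. Hence a linear form that does not distinguish two of the
  generators in a relation cannot see the relation.
\<close>

lemma ext_boundary_factor:
  assumes "distinct xs" "i \<in> set xs" "j \<in> set xs" "i \<noteq> j"
  obtains w where "ext_boundary xs = wedge (ext_gen i - ext_gen j) w"
proof -
  let ?zs = "sorted_list_of_set (set xs - {i, j})"
  let ?m = "ext_monomial ?zs" and ?c = "contract (\<lambda>_. 1)"
  have d: "distinct (i # j # ?zs)" using assms(4) by simp
  have s: "set (i # j # ?zs) = set xs" using assms by auto
  obtain c where c: "ext_monomial xs = c *s axis (set xs) 1"
    using ext_monomial_distinct[OF assms(1)] .
  obtain c' where c': "axis (set xs) 1 = c' *s ext_monomial (i # j # ?zs)"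
    using axis_eq_ext_monomial[OF d] unfolding s .
  have "ext_boundary xs = - (c * c') *s ?c (wedge (ext_gen i) (wedge (ext_gen j) ?m))"
    by (simp add: ext_boundary_eq_contract c c' ext_monomial_Cons contract_scale vector_smult_assoc)
  also have "?c (wedge (ext_gen i) (wedge (ext_gen j) ?m)) =
      wedge (ext_gen j) ?m - wedge (ext_gen i) ?m + wedge (ext_gen i) (wedge (ext_gen j) (?c ?m))"
    by (simp add: contract_wedge_ext_gen wedge_diff_right)
  also have "\<dots> = wedge (ext_gen i - ext_gen j) (wedge (ext_gen j) (?c ?m) - ?m)"
    by (simp add: wedge_diff_right wedge_diff_left wedge_ext_gen_self flip: wedge_assoc)
  finally show ?thesis
    by (intro that) (simp add: wedge_scale_right[symmetric])
qed

definition degree_ge :: "nat \<Rightarrow> 'l::{finite,linorder} ext set" where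
  "degree_ge m = {y. \<forall>S. card S < m \<longrightarrow> y $ S = 0}"

lemma degree_ge_wedge_left:
  assumes "y \<in> degree_ge m"
  shows "wedge a y \<in> degree_ge m"
proof -
  have "y $ (S - T) = 0" if "card S < m" for S T
  proof -
    have "card (S - T) \<le> card S" by (rule card_mono) auto
    with that assms show ?thesis by (simp add: degree_ge_def)
  qed
  then show ?thesis by (simp add: degree_ge_def wedge_def)
qed

lemma degree_ge_wedge_right:
  assumes "y \<in> degree_ge m"
  shows "wedge y b \<in> degree_ge m"
proof -
  have "y $ T = 0" if "card S < m" "T \<subseteq> S" for S T
  proof -
    have "card T \<le> card S" using that(2) by (rule card_mono[rotated]) auto
    with that assms show ?thesis by (simp add: degree_ge_def)
  qed
  then show ?thesis by (auto simp: degree_ge_def wedge_def intro!: sum.neutral)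
qed

lemma degree_ge_contract: "y \<in> degree_ge (Suc m) \<Longrightarrow> contract f y \<in> degree_ge m"
  unfolding degree_ge_def contract_def by (auto intro!: sum.neutral)

lemma degree_ge_ext_monomial: "distinct xs \<Longrightarrow> ext_monomial xs \<in> degree_ge (length xs)"
  using distinct_card[of xs]
  by (auto elim!: ext_monomial_distinct simp: degree_ge_def axis_def)

lemma product_homogeneous:
  "foldr wedge (map ext_embed vs) (axis {} 1) $ S = 0" if "card S \<noteq> length vs"
  using that
proof (induction vs arbitrary: S)
  case Nil
  then show ?case by (auto simp: axis_def)
next
  case (Cons v vs)
  let ?P = "foldr wedge (map ext_embed vs) (axis {} 1)"
  have "wedge (ext_gen i) ?P $ S = 0" for i
  proof (cases "i \<in> S")
    case True
    then have "card (S - {i}) \<noteq> length vs" using Cons.prems card_Suc_Diff1[of S i] by auto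
    then show ?thesis by (simp add: wedge_ext_gen_nth Cons.IH del: card_Diff_insert)
  qed (simp add: wedge_ext_gen_nth)
  then show ?case
    by (simp add: ext_embed_def[of v] wedge_sum_left wedge_scale_left)
qed

section \<open>Codimensions of intersections\<close>

lemma span_Union_projectivization:
  fixes W :: "(complex ^ 'd) set"
  assumes "vec.subspace W"
  shows "vec.span (\<Union> (projectivization W)) = W"
proof
  show "vec.span (\<Union> (projectivization W)) \<subseteq> W"
    using assms by (intro vec.span_minimal) (auto simp: projectivization_def)
  show "W \<subseteq> vec.span (\<Union> (projectivization W))"
  proof
    fix x assume x: "x \<in> W"
    show "x \<in> vec.span (\<Union> (projectivization W))"
    proof (cases "x = 0")
      case False
      then have "vec.dim (vec.span {x}) = 1"
        unfolding vec.dim_span using vec.dim_insert[of x "{}"] by simp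
      moreover have "vec.span {x} \<subseteq> W" using x assms by (intro vec.span_minimal) auto
      ultimately have "vec.span {x} \<in> projectivization W"
        by (simp add: projectivization_def proj_points_def)
      then show ?thesis using vec.span_base by blast
    qed (simp add: vec.span_zero)
  qed
qed

lemma lin_dim_projectivization:
  "vec.subspace W \<Longrightarrow> lin_dim (projectivization W) = vec.dim W"
  by (simp add: lin_dim_def span_Union_projectivization)

lemma arrangement_subspaces:
  fixes H :: "'l \<Rightarrow> (complex ^ 'd) set set"
  assumes "is_arrangement H"
  shows "\<exists>U. (\<forall>i. vec.subspace (U i)) \<and> (\<forall>i. vec.dim (U i) + 1 = CARD('d)) \<and>
    (\<forall>I. meet H I = projectivization (\<Inter>i\<in>I. U i)) \<and> (\<forall>i. H i = projectivization (U i))"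
proof -
  obtain U where U: "\<And>i. vec.subspace (U i) \<and> vec.dim (U i) + 1 = CARD('d) \<and> H i = projectivization (U i)"
    using assms unfolding is_arrangement_def is_hyperplane_def by metis
  moreover have "meet H I = projectivization (\<Inter>i\<in>I. U i)" for I
    using U by (auto simp: meet_def projectivization_def)
  ultimately show ?thesis by metis
qed

lemma lin_dim_mono: "S \<subseteq> T \<Longrightarrow> lin_dim S \<le> lin_dim T"
  unfolding lin_dim_def by (intro vec.dim_subset vec.span_mono Union_mono)

lemma lin_dim_plus_codim: "lin_dim (S :: (complex ^ 'd) set set) + codim S = CARD('d)"
proof -
  have "lin_dim S \<le> CARD('d)"
    unfolding lin_dim_def using vec.dim_subset[of "vec.span (\<Union>S)" UNIV] by (simp add: card_cart_basis)
  then show ?thesis by (simp add: codim_def)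
qed

lemma codim_antimono: "S \<subseteq> T \<Longrightarrow> codim T \<le> codim S"
  unfolding codim_def using lin_dim_mono by (rule diff_le_mono2)

lemma codim_empty: "codim ({} :: (complex ^ 'd) set set) = CARD('d)"
  by (simp add: codim_def lin_dim_def)

lemma meet_insert_absorb: "meet H I \<subseteq> H i \<Longrightarrow> meet H (insert i I) = meet H I"
  by (auto simp: meet_def)

lemma meet_antimono: "I \<subseteq> J \<Longrightarrow> meet H J \<subseteq> meet H I"
  by (auto simp: meet_def)

lemma meet_subset: "i \<in> I \<Longrightarrow> meet H I \<subseteq> H i"
  by (auto simp: meet_def)

lemma codim_meet_empty: 
  fixes H :: "'l \<Rightarrow> (complex ^ 'd) set set"
  assumes "is_arrangement H"
  shows "codim (meet H {}) = 0"
proof -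
  obtain U where U: "\<And>i. vec.subspace (U i)" "\<And>i. vec.dim (U i) + 1 = CARD('d)"
    "\<And>I. meet H I = projectivization (\<Inter>i\<in>I. U i)" "\<And>i. H i = projectivization (U i)"
    using arrangement_subspaces[OF assms] by blast
  show ?thesis
    by (simp add: U(3) codim_def lin_dim_projectivization vec.subspace_UNIV card_cart_basis)
qed

text \<open>
  A hyperplane cuts a linear subspace that it does not contain down by exactly one dimension.
  Together with monotonicity of the codimension, this and the codimension \<open>0\<close> of the empty
  intersection are the linear algebra of hyperplanes that the combinatorial arguments rest on.
\<close>

lemma codim_meet_insert:
  fixes H :: "'l \<Rightarrow> (complex ^ 'd) set set"
  assumes "is_arrangement H" "\<not> meet H I \<subseteq> H i"
  shows "codim (meet H (insert i I)) = Suc (codim (meet H I))"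
proof -
  obtain U where U: "\<And>i. vec.subspace (U i)" "\<And>i. vec.dim (U i) + 1 = CARD('d)"
    "\<And>I. meet H I = projectivization (\<Inter>i\<in>I. U i)" "\<And>i. H i = projectivization (U i)"
    using arrangement_subspaces[OF assms(1)] by blast
  let ?W = "\<Inter>i\<in>I. U i"
  have sW: "vec.subspace ?W" using U(1) by (intro vec.subspace_Inter) auto
  have "\<not> ?W \<subseteq> U i" using assms(2) unfolding U(3) U(4) projectivization_def by auto
  then obtain w where w: "w \<in> ?W" "w \<notin> U i" by blast
  have sub: "insert w (U i) \<subseteq> {x + y | x y. x \<in> ?W \<and> y \<in> U i}"
  proof
    fix z assume "z \<in> insert w (U i)"
    then consider "z = w + 0" | "z = 0 + z" "z \<in> U i" by auto
    then show "z \<in> {x + y | x y. x \<in> ?W \<and> y \<in> U i}"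
      using w(1) vec.subspace_0[OF U(1)] vec.subspace_0[OF sW] by cases blast+
  qed
  have "CARD('d) = vec.dim (insert w (U i))"
    using w(2) U(1,2)[of i] by (simp add: vec.dim_insert vec.span_eq_iff[THEN iffD2])
  also have "\<dots> \<le> vec.dim {x + y | x y. x \<in> ?W \<and> y \<in> U i}"
    using sub by (rule vec.dim_subset)
  finally have "CARD('d) \<le> vec.dim {x + y | x y. x \<in> ?W \<and> y \<in> U i}" .
  moreover have "vec.dim {x + y | x y. x \<in> ?W \<and> y \<in> U i} \<le> CARD('d)"
    using vec.dim_subset[of "{x + y | x y. x \<in> ?W \<and> y \<in> U i}" UNIV] by (simp add: card_cart_basis)
  moreover have "vec.dim {x + y | x y. x \<in> ?W \<and> y \<in> U i} + vec.dim (?W \<inter> U i) =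
      vec.dim ?W + vec.dim (U i)"
    by (rule vec.dim_sums_Int[OF sW U(1)])
  ultimately have "vec.dim ?W = Suc (vec.dim (?W \<inter> U i))" using U(2)[of i] by linarith
  moreover have "lin_dim (meet H (insert i I)) = vec.dim (?W \<inter> U i)"
    unfolding U(3) using sW U(1) by (simp add: Int_commute lin_dim_projectivization vec.subspace_inter)
  moreover have "lin_dim (meet H I) = vec.dim ?W"
    unfolding U(3) by (rule lin_dim_projectivization[OF sW])
  ultimately show ?thesis
    using lin_dim_plus_codim[of "meet H I"] lin_dim_plus_codim[of "meet H (insert i I)"] by linarith
qed

lemma codim_meet_le_card:
  assumes "is_arrangement H" "finite I"
  shows "codim (meet H I) \<le> card I"
  using assms(2)
proof induction
  case empty
  then show ?case by (simp add: codim_meet_empty[OF assms(1)])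
next
  case (insert i I)
  then show ?case
    using codim_meet_insert[OF assms(1), of I i] meet_insert_absorb[of H I i]
    by (cases "meet H I \<subseteq> H i") auto
qed

lemma meet_nonempty:
  fixes H :: "'l \<Rightarrow> (complex ^ 'd) set set"
  assumes "is_arrangement H" "finite I" "card I < CARD('d)"
  shows "meet H I \<noteq> {}"
  using codim_meet_le_card[OF assms(1,2)] assms(3) codim_empty[where ?'d = 'd] by force

lemma not_proj_points_subset_hyperplane:
  fixes H :: "'l \<Rightarrow> (complex ^ 'd) set set"
  assumes "is_arrangement H"
  shows "\<not> meet H {} \<subseteq> H i"
proof
  assume sub: "meet H {} \<subseteq> H i"
  have "codim (H i) = 1"
  proof -
    obtain U where U: "\<And>i. vec.subspace (U i)" "\<And>i. vec.dim (U i) + 1 = CARD('d)"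
    "\<And>I. meet H I = projectivization (\<Inter>i\<in>I. U i)" "\<And>i. H i = projectivization (U i)"
    using arrangement_subspaces[OF assms] by blast
    show ?thesis using U(1,2)[of i] by (simp add: U(4) codim_def lin_dim_projectivization)
  qed
  then show False using codim_antimono[OF sub] codim_meet_empty[OF assms] by simp
qed

section \<open>Levels of hyperplanes along a flag\<close>

text \<open>
  A flag sorts the hyperplanes by the largest of its members that they contain. Since its members
  are nested, counting the members contained in \<open>H i\<close> gives the index of the largest one, and
  \<open>0\<close> if there is none.
\<close>

definition flag_level :: "('l \<Rightarrow> (complex ^ 'd) set set) \<Rightarrow> nat \<Rightarrow> (nat \<Rightarrow> (complex ^ 'd) set set) \<Rightarrow> 'l \<Rightarrow> nat" where
  "flag_level H k S i = card {q \<in> {1..k}. S q \<subseteq> H i}"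

lemma truncated_flag_mono:
  assumes "truncated_flag H n k S" "1 \<le> p" "p \<le> q" "q \<le> k"
  shows "S p \<subseteq> S q"
  using assms(3,4)
proof (induction q rule: dec_induct)
  case (step q)
  moreover have "S q \<subset> S (q + 1)" using assms(1,2) step by (simp add: truncated_flag_def)
  ultimately show ?case by auto
qed simp

lemma flag_subset_iff_level:
  assumes "truncated_flag H n k S" "q \<in> {1..k}"
  shows "S q \<subseteq> H i \<longleftrightarrow> q \<le> flag_level H k S i"
proof
  assume "S q \<subseteq> H i"
  then have "{1..q} \<subseteq> {q \<in> {1..k}. S q \<subseteq> H i}"
    using truncated_flag_mono[OF assms(1), of _ q] assms(2) by fastforce
  then have "card {1..q} \<le> flag_level H k S i"
    unfolding flag_level_def by (intro card_mono) auto
  then show "q \<le> flag_level H k S i" by simp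
next
  assume q: "q \<le> flag_level H k S i"
  show "S q \<subseteq> H i"
  proof (rule ccontr)
    assume n: "\<not> S q \<subseteq> H i"
    have "{p \<in> {1..k}. S p \<subseteq> H i} \<subseteq> {1..<q}"
    proof
      fix p assume p: "p \<in> {p \<in> {1..k}. S p \<subseteq> H i}"
      then have "\<not> q \<le> p"
        using truncated_flag_mono[OF assms(1), of q p] assms(2) n by auto
      with p show "p \<in> {1..<q}" by auto
    qed
    then have "flag_level H k S i \<le> card {1..<q}"
      unfolding flag_level_def by (intro card_mono) auto
    with q assms(2) show False by auto
  qed
qed

lemma flag_level_le: "flag_level H k S i \<le> k"
  unfolding flag_level_def using card_mono[of "{1..k}" "{q \<in> {1..k}. S q \<subseteq> H i}"] by fastforce

text \<open>
  Add the hyperplanes by decreasing level. Those already present all contain the flag member just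
  above the level of the new one, whereas the new one does not, so every step raises the
  codimension. The consequence used later is the contrapositive: hyperplanes that meet
  non-generically include two of the same level, which the flag cannot tell apart.
\<close>

lemma codim_of_distinct_levels:
  assumes A: "is_arrangement H" and F: "truncated_flag H n k S"
    and "finite I" and "inj_on (flag_level H k S) I"
  shows "codim (meet H I) = card I"
  using assms(3,4)
proof (induction I rule: finite_ranking_induct[where f = "\<lambda>i. - int (flag_level H k S i)"])
  case empty
  then show ?case by (simp add: codim_meet_empty[OF A])
next
  case (insert x I)
  show ?case
  proof (cases "x \<in> I")
    case True
    then show ?thesis using insert by (simp add: insert_absorb)
  next
    case False
    have lt: "flag_level H k S x < flag_level H k S y" if "y \<in> I" for y
    proof -
      have "flag_level H k S x \<noteq> flag_level H k S y"
        using insert.prems False that by (auto simp: inj_on_def)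
      moreover have "- int (flag_level H k S y) \<le> - int (flag_level H k S x)"
        using insert.hyps(2) that by auto
      ultimately show ?thesis by simp
    qed
    \<comment> \<open>Ranking by the negative of the level makes \<open>x\<close> the hyperplane of least level.\<close>
    have "\<not> meet H I \<subseteq> H x"
    proof (cases "I = {}")
      case True
      then show ?thesis using not_proj_points_subset_hyperplane[OF A] by simp
    next
      case False
      then obtain y where "y \<in> I" by auto
      let ?q = "Suc (flag_level H k S x)"
      have q: "?q \<in> {1..k}" using lt[OF \<open>y \<in> I\<close>] flag_level_le[of H k S y] by simp
      have "S ?q \<subseteq> H y" if "y \<in> I" for y
        using flag_subset_iff_level[OF F q] lt[OF that] by auto
      moreover have "S ?q \<subseteq> proj_points"
        using F q by (auto simp: truncated_flag_def flats_def meet_def)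
      ultimately have "S ?q \<subseteq> meet H I" by (auto simp: meet_def)
      moreover have "\<not> S ?q \<subseteq> H x" using flag_subset_iff_level[OF F q] by auto
      ultimately show ?thesis by blast
    qed
    then show ?thesis
      using codim_meet_insert[OF A, of I x] insert False by (simp add: inj_on_insert)
  qed
qed

section \<open>Sets without broken circuits\<close>

text \<open>
  These are the index sets that contain no broken circuit, that is, no minimal dependent set with
  its least element removed. Quantifying over all \<open>B\<close>, and not only over minimal ones, avoids
  speaking of circuits. Taking for \<open>m\<close> the least element of a subset of \<open>T\<close> and for \<open>B\<close> the
  rest of it shows that such a set \<open>T\<close> is independent.
\<close>

definition nbc :: "('l::linorder \<Rightarrow> (complex ^ 'd) set set) \<Rightarrow> 'l set \<Rightarrow> bool" where
  "nbc H T \<longleftrightarrow> (\<forall>m B. B \<subseteq> T \<and> (\<forall>b\<in>B. m < b) \<longrightarrow> codim (meet H (insert m B)) = Suc (card B))"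

lemma nbcD:
  assumes "nbc H T" "B \<subseteq> T" "\<forall>b\<in>B. m < b"
  shows "codim (meet H (insert m B)) = Suc (card B)"
  using assms unfolding nbc_def by blast

lemma nbc_codim:
  fixes H :: "'l::{finite,linorder} \<Rightarrow> (complex ^ 'd) set set"
  assumes "is_arrangement H" "nbc H T" "B \<subseteq> T"
  shows "codim (meet H B) = card B"
proof (cases "B = {}")
  case True
  then show ?thesis by (simp add: codim_meet_empty[OF assms(1)])
next
  case False
  then have m: "Min B \<in> B" by simp
  have "\<forall>b\<in>B - {Min B}. Min B < b" by (auto simp: order_less_le)
  then have "codim (meet H (insert (Min B) (B - {Min B}))) = Suc (card (B - {Min B}))"
    using assms(2,3) unfolding nbc_def by blast
  then show ?thesis using m card_Suc_Diff1[of B "Min B"] by (simp add: insert_absorb)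
qed

text \<open>
  For \<open>I = {i\<^sub>1 < \<dots> < i\<^sub>k}\<close> the member with index \<open>p\<close> is \<open>H\<^sub>i\<^sub>p \<inter> \<dots> \<inter> H\<^sub>i\<^sub>k\<close>. Lists count from
  \<open>0\<close>, whence the shift.
\<close>

definition nbc_flag :: "('l::{finite,linorder} \<Rightarrow> (complex ^ 'd) set set) \<Rightarrow> 'l set \<Rightarrow> nat \<Rightarrow> (complex ^ 'd) set set" where
  "nbc_flag H I p = meet H (set (drop (p - 1) (sorted_list_of_set I)))"

lemma card_drop_sorted_list:
  "card (set (drop j (sorted_list_of_set (I :: 'l::{finite,linorder} set)))) = card I - j"
  by (simp add: distinct_card distinct_drop)

lemma nbc_flag_truncated:
  fixes H :: "'l::{finite,linorder} \<Rightarrow> (complex ^ 'd) set set"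
  assumes A: "is_arrangement H" and n: "CARD('d) = n + 1" and I: "nbc H I" "card I \<le> n"
  shows "truncated_flag H n (card I) (nbc_flag H I)"
proof -
  let ?d = "\<lambda>p. set (drop (p - 1) (sorted_list_of_set I))"
  have sub: "?d p \<subseteq> I" for p using set_drop_subset[of "p - 1" "sorted_list_of_set I"] by simp
  have dim: "lin_dim (nbc_flag H I p) = p + n - card I" if "p \<in> {1..card I}" for p
    using nbc_codim[OF A I(1) sub, of p] card_drop_sorted_list[of "p - 1" I]
      lin_dim_plus_codim[of "nbc_flag H I p"] n that
    by (auto simp: nbc_flag_def)
  have "nbc_flag H I p \<in> flats H" if "p \<in> {1..card I}" for p
  proof -
    have "nbc_flag H I p \<noteq> {}"
      using card_mono[OF _ sub[of p]] I(2) n unfolding nbc_flag_def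
      by (intro meet_nonempty[OF A]) auto
    then show ?thesis by (auto simp: flats_def nbc_flag_def)
  qed
  moreover have "nbc_flag H I p \<subset> nbc_flag H I (p + 1)" if "p \<in> {1..<card I}" for p
  proof -
    have "nbc_flag H I p \<subseteq> nbc_flag H I (p + 1)"
      unfolding nbc_flag_def by (intro meet_antimono set_drop_subset_set_drop) simp
    moreover have "lin_dim (nbc_flag H I p) \<noteq> lin_dim (nbc_flag H I (p + 1))"
      using dim[of p] dim[of "p + 1"] that I(2) by simp
    ultimately show ?thesis by auto
  qed
  ultimately show ?thesis using dim by (auto simp: truncated_flag_def)
qed

lemma drop_sorted_list_ge:
  assumes "p < card I" "b \<in> set (drop p (sorted_list_of_set (I :: 'l::{finite,linorder} set)))"
  shows "sorted_list_of_set I ! p \<le> b"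
proof -
  let ?xs = "sorted_list_of_set I"
  obtain j where "j < length (drop p ?xs)" "drop p ?xs ! j = b"
    using assms(2) by (meson in_set_conv_nth)
  then have "b = ?xs ! (p + j)" "p + j < length ?xs" by auto
  then show ?thesis by (simp add: sorted_nth_mono)
qed

text \<open>
  Suppose a hyperplane below \<open>i\<^sub>p\<close> contained the flag member \<open>H\<^sub>i\<^sub>p \<inter> \<dots> \<inter> H\<^sub>i\<^sub>k\<close>. Adding it to
  \<open>i\<^sub>p, \<dots>, i\<^sub>k\<close> would not raise the codimension, although a set without broken circuits demands
  that it does. So \<open>i\<^sub>p\<close> can be recovered from the flag as the least hyperplane containing its
  \<open>p\<close>-th member.
\<close>

lemma nbc_flag_min:
  fixes H :: "'l::{finite,linorder} \<Rightarrow> (complex ^ 'd) set set"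
  assumes A: "is_arrangement H" and I: "nbc H I" and p: "p \<in> {1..card I}" and m: "nbc_flag H I p \<subseteq> H m"
  shows "sorted_list_of_set I ! (p - 1) \<le> m"
proof (rule ccontr)
  assume less: "\<not> sorted_list_of_set I ! (p - 1) \<le> m"
  let ?B = "set (drop (p - 1) (sorted_list_of_set I))"
  have sub: "?B \<subseteq> I" using set_drop_subset[of "p - 1" "sorted_list_of_set I"] by simp
  have "p - 1 < card I" using p by auto
  then have "\<forall>b\<in>?B. m < b" using drop_sorted_list_ge[of "p - 1" I] less by force
  then have "codim (meet H (insert m ?B)) = Suc (card ?B)" using I sub unfolding nbc_def by blast
  then show False using nbc_codim[OF A I sub] m meet_insert_absorb[of H ?B m]
    by (simp add: nbc_flag_def)
qed

lemma nbc_flag_subset_nth: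
  "p \<in> {1..card I} \<Longrightarrow> nbc_flag H I p \<subseteq> H (sorted_list_of_set I ! (p - 1))"
  unfolding nbc_flag_def
  by (intro meet_subset) (use in_set_conv_nth[of "sorted_list_of_set I ! (p - 1)" "drop (p - 1) (sorted_list_of_set I)"] in force)

lemma nbc_flag_not_subset_nth:
  fixes H :: "'l::{finite,linorder} \<Rightarrow> (complex ^ 'd) set set"
  assumes A: "is_arrangement H" and I: "nbc H I" and "1 \<le> p" "p < q" "q \<le> card I"
  shows "\<not> nbc_flag H I q \<subseteq> H (sorted_list_of_set I ! (p - 1))"
proof
  assume "nbc_flag H I q \<subseteq> H (sorted_list_of_set I ! (p - 1))"
  then have "sorted_list_of_set I ! (q - 1) \<le> sorted_list_of_set I ! (p - 1)"
    using nbc_flag_min[OF A I, of q] assms(3-5) by simp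
  moreover have "sorted_list_of_set I ! (p - 1) < sorted_list_of_set I ! (q - 1)"
    using strict_sorted_list_of_set[of I] assms(3-5) by (simp add: sorted_wrt_nth_less)
  ultimately show False by simp
qed

text \<open>
  The flag of \<open>I\<close> is compatible with only one set without broken circuits, namely \<open>I\<close>. If the
  levels of \<open>J\<close> run through \<open>1, \<dots>, k\<close>, then the elements of level at least \<open>p\<close> are as many as
  the codimension of the \<open>p\<close>-th flag member, which they all contain. If the least hyperplane
  \<open>i\<^sub>p\<close> containing that member were not among them, adding it would, as \<open>J\<close> has no broken
  circuit, produce an intersection of larger codimension that still contains the member.
\<close>

lemma nbc_flag_determines:
  fixes H :: "'l::{finite,linorder} \<Rightarrow> (complex ^ 'd) set set"
  assumes A: "is_arrangement H" and n: "CARD('d) = n + 1"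
    and I: "nbc H I" "card I \<le> n" and J: "nbc H J" "card J = card I"
    and inj: "inj_on (flag_level H (card I) (nbc_flag H I)) J"
    and pos: "\<And>j. j \<in> J \<Longrightarrow> flag_level H (card I) (nbc_flag H I) j \<noteq> 0"
  shows "J = I"
proof -
  let ?k = "card I" and ?S = "nbc_flag H I" and ?xs = "sorted_list_of_set I"
  let ?l = "flag_level H ?k ?S"
  have F: "truncated_flag H n ?k ?S" by (rule nbc_flag_truncated[OF A n I])
  have "?l ` J \<subseteq> {1..?k}" using pos flag_level_le[of H ?k ?S] by (auto simp: Suc_le_eq)
  then have img: "?l ` J = {1..?k}"
    using card_image[OF inj] J(2) by (intro card_subset_eq) auto
  have "?xs ! (p - 1) \<in> J" if p: "p \<in> {1..?k}" for p
  proof (rule ccontr)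
    assume notin: "?xs ! (p - 1) \<notin> J"
    let ?J = "{j \<in> J. p \<le> ?l j}"
    have sub: "?S p \<subseteq> H j" if "j \<in> ?J" for j using flag_subset_iff_level[OF F p] that by simp
    have "?l ` ?J = ?l ` J \<inter> {p..}" by auto
    also have "\<dots> = {p..?k}" unfolding img using p by auto
    finally have "?l ` ?J = {p..?k}" .
    moreover have "card (?l ` ?J) = card ?J" by (rule card_image) (rule inj_on_subset[OF inj], auto)
    ultimately have c: "card ?J = Suc ?k - p" by simp
    have "\<forall>b\<in>?J. ?xs ! (p - 1) < b"
    proof
      fix b assume "b \<in> ?J"
      then have "?xs ! (p - 1) \<le> b" "b \<noteq> ?xs ! (p - 1)"
        using nbc_flag_min[OF A I(1) p sub] notin by blast+
      then show "?xs ! (p - 1) < b" by simp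
    qed
    then have "codim (meet H (insert (?xs ! (p - 1)) ?J)) = Suc (card ?J)"
      by (intro nbcD[OF J(1)]) auto
    moreover have "?S p \<subseteq> meet H (insert (?xs ! (p - 1)) ?J)"
    proof -
      have "?S p \<subseteq> proj_points" by (auto simp: meet_def nbc_flag_def)
      then show ?thesis using sub nbc_flag_subset_nth[OF p, of H] unfolding meet_def by blast
    qed
    then have "codim (meet H (insert (?xs ! (p - 1)) ?J)) \<le> codim (?S p)" by (rule codim_antimono)
    moreover have "lin_dim (?S p) = p + n - ?k" using F p by (simp add: truncated_flag_def)
    ultimately show False
      using c lin_dim_plus_codim[of "?S p"] n p I(2) by auto
  qed
  moreover have "\<exists>p\<in>{1..?k}. i = ?xs ! (p - 1)" if "i \<in> I" for i
  proof -
    obtain j where "j < length ?xs" "?xs ! j = i"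
      using \<open>i \<in> I\<close> by (metis finite in_set_conv_nth set_sorted_list_of_set)
    then show ?thesis by (intro bexI[of _ "Suc j"]) auto
  qed
  ultimately have "I \<subseteq> J" by blast
  then show ?thesis using J(2) by (metis card_subset_eq finite)
qed

section \<open>Flag functionals\<close>

primrec iterated_contraction ::
  "(nat \<Rightarrow> 'l \<Rightarrow> complex) \<Rightarrow> nat \<Rightarrow> 'l::{finite,linorder} ext \<Rightarrow> 'l ext" where
  "iterated_contraction \<phi> 0 y = y"
| "iterated_contraction \<phi> (Suc k) y = iterated_contraction \<phi> k (contract (\<phi> (Suc k)) y)"

lemma iterated_contraction_add:
  "iterated_contraction \<phi> k (x + y) = iterated_contraction \<phi> k x + iterated_contraction \<phi> k y"
  by (induction k arbitrary: x y) (simp_all add: contract_add)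

lemma iterated_contraction_scale:
  "iterated_contraction \<phi> k (c *s y) = c *s iterated_contraction \<phi> k y"
  by (induction k arbitrary: y) (simp_all add: contract_scale)

lemma iterated_contraction_zero [simp]: "iterated_contraction \<phi> k 0 = 0"
  by (induction k) simp_all

lemma iterated_contraction_minus:
  "iterated_contraction \<phi> k (- y) = - iterated_contraction \<phi> k y"
  by (induction k arbitrary: y) (simp_all add: contract_minus)

lemma iterated_contraction_sum:
  "iterated_contraction \<phi> k (\<Sum>i\<in>I. f i) = (\<Sum>i\<in>I. iterated_contraction \<phi> k (f i))"
  by (induction I rule: infinite_finite_induct) (simp_all add: iterated_contraction_add)

lemma degree_ge_iterated_contraction:
  "y \<in> degree_ge (m + k) \<Longrightarrow> iterated_contraction \<phi> k y \<in> degree_ge m"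
  by (induction k arbitrary: y) (simp_all add: degree_ge_contract)

lemma wedge_ext_embed_nth_empty [simp]: "wedge (ext_embed v) y $ {} = 0"
  by (simp add: wedge_def ext_embed_def ext_gen_def axis_def)

text \<open>
  A vector killed by all forms only picks up a sign when it passes through the contractions, so the
  result remains a multiple of it and has no constant term.
\<close>

lemma iterated_contraction_wedge_null:
  assumes "\<And>q. q \<in> {1..k} \<Longrightarrow> pairing (\<phi> q) v = 0"
  shows "iterated_contraction \<phi> k (wedge (ext_embed v) y) $ {} = 0"
  using assms
proof (induction k arbitrary: y)
  case (Suc k)
  have "contract (\<phi> (Suc k)) (wedge (ext_embed v) y) =
      - wedge (ext_embed v) (contract (\<phi> (Suc k)) y)"
    using Suc.prems[of "Suc k"] by (simp add: contract_wedge_ext_embed)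
  then show ?case using Suc by (simp add: iterated_contraction_minus)
qed simp

lemma iterated_contraction_contract:
  "s \<in> {1..k} \<Longrightarrow> iterated_contraction \<phi> k (contract (\<phi> s) y) = 0"
proof (induction k arbitrary: y)
  case (Suc k)
  show ?case
  proof (cases "s = Suc k")
    case True
    then show ?thesis by (simp add: contract_contract_self)
  next
    case False
    then have "s \<in> {1..k}" using Suc.prems by auto
    then show ?thesis
      using Suc.IH by (simp add: contract_anticommute[of "\<phi> (Suc k)"] iterated_contraction_minus)
  qed
qed simp

text \<open>
  If on \<open>y\<close> the contraction with \<open>\<phi> t\<close> agrees with one that the later contractions annihilate,
  then the whole composite vanishes. Anticommutation carries the agreement from \<open>y\<close> through the
  contractions with \<open>\<phi> k, \<dots>, \<phi> (t + 1)\<close>, which come before.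
\<close>

lemma iterated_contraction_dependent:
  assumes "t \<in> {1..k}"
    and "contract (\<lambda>i. \<phi> t i - f i) y = 0"
    and "\<And>z. iterated_contraction \<phi> (t - 1) (contract f z) = 0"
  shows "iterated_contraction \<phi> k y = 0"
  using assms(1,2)
proof (induction k arbitrary: y)
  case (Suc k)
  show ?case
  proof (cases "t = Suc k")
    case True
    have "contract (\<phi> t) y = contract (\<lambda>i. \<phi> t i - f i) y + contract f y"
      by (simp flip: contract_add_fun)
    then show ?thesis using True Suc.prems(2) assms(3) by simp
  next
    case False
    then have "t \<in> {1..k}" using Suc.prems by auto
    moreover have "contract (\<lambda>i. \<phi> t i - f i) (contract (\<phi> (Suc k)) y) = 0"
      using Suc.prems(2) contract_anticommute[of "\<lambda>i. \<phi> t i - f i" "\<phi> (Suc k)" y] by simp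
    ultimately show ?thesis using Suc.IH by simp
  qed
qed simp

lemma contract_null_product:
  assumes "\<And>v. v \<in> set vs \<Longrightarrow> pairing g v = 0"
  shows "contract g (foldr wedge (map ext_embed vs) (axis {} 1)) = 0"
  using assms by (induction vs) (simp_all add: contract_wedge_ext_embed)

text \<open>
  When the forms and the vectors have a unitriangular matrix of values, each contraction
  strips off exactly the first factor of what is left: by the antiderivation rule the
  remaining terms involve a later vector factor on which the form vanishes. This replaces the
  evaluation of a determinant.
\<close>

lemma iterated_contraction_dual_product:
  assumes "\<And>p. p \<in> {1..k} \<Longrightarrow> pairing (\<phi> p) (\<alpha> p) = 1"
    and "\<And>p q. 1 \<le> q \<Longrightarrow> q < p \<Longrightarrow> p \<le> k \<Longrightarrow> pairing (\<phi> p) (\<alpha> q) = 0"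
  shows "iterated_contraction \<phi> k (foldr wedge (map ext_embed (rev (map \<alpha> [1..<Suc k]))) (axis {} 1))
    = axis {} 1"
  using assms
proof (induction k)
  case (Suc k)
  let ?P = "foldr wedge (map ext_embed (rev (map \<alpha> [1..<Suc k]))) (axis {} 1)"
  have "contract (\<phi> (Suc k)) ?P = 0"
    using Suc.prems(2) by (intro contract_null_product) auto
  moreover have "pairing (\<phi> (Suc k)) (\<alpha> (Suc k)) = 1" using Suc.prems(1) by simp
  moreover have "foldr wedge (map ext_embed (rev (map \<alpha> [1..<Suc (Suc k)]))) (axis {} 1) =
      wedge (ext_embed (\<alpha> (Suc k))) ?P"
    by simp
  moreover have "iterated_contraction \<phi> k ?P = axis {} 1"
    using Suc by simp
  ultimately show ?case by (simp only: iterated_contraction.simps contract_wedge_ext_embed) simp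
qed simp

definition incidence :: "('l \<Rightarrow> (complex ^ 'd) set set) \<Rightarrow> (complex ^ 'd) set set \<Rightarrow> 'l \<Rightarrow> complex" where
  "incidence H S i = (if S \<subseteq> H i then 1 else 0)"

text \<open>
  On a product of \<open>k\<close> vectors \<open>\<alpha>\<^sub>1, \<dots>, \<alpha>\<^sub>k\<close> this is, up to sign, the determinant of the matrix
  with entries \<open>\<alpha>\<^sub>p(S\<^sub>q) = \<Sum>\<^bsub>H\<^sub>i \<supseteq> S\<^sub>q\<^esub> \<alpha>\<^sub>p\<^sub>i\<close>. Writing it as an iterated contraction defines it
  at once on the whole exterior algebra and gives its alternating behaviour without permutations.
\<close>

definition flag_functional ::
  "('l::{finite,linorder} \<Rightarrow> (complex ^ 'd) set set) \<Rightarrow> nat \<Rightarrow> (nat \<Rightarrow> (complex ^ 'd) set set)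
    \<Rightarrow> 'l ext \<Rightarrow> complex" where
  "flag_functional H k S y = iterated_contraction (\<lambda>q. incidence H (S q)) k y $ {}"

lemma flag_functional_add: "flag_functional H k S (x + y) = flag_functional H k S x + flag_functional H k S y"
  and flag_functional_minus: "flag_functional H k S (- y) = - flag_functional H k S y"
  and flag_functional_scale: "flag_functional H k S (c *s y) = c * flag_functional H k S y"
  and flag_functional_zero [simp]: "flag_functional H k S 0 = 0"
  by (simp_all add: flag_functional_def iterated_contraction_add iterated_contraction_minus
      iterated_contraction_scale)

lemma flag_functional_sum: "flag_functional H k S (\<Sum>i\<in>I. f i) = (\<Sum>i\<in>I. flag_functional H k S (f i))"
  by (simp add: flag_functional_def iterated_contraction_sum)

lemma pairing_axis: "pairing f (axis i 1) = f i"
  by (simp add: pairing_def axis_def if_distrib[of "\<lambda>c. _ * c"] cong: if_cong)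

lemma pairing_add: "pairing f (u + v) = pairing f u + pairing f v"
  and pairing_scale: "pairing f (c *s v) = c * pairing f v"
  and pairing_diff: "pairing f (u - v) = pairing f u - pairing f v"
  and pairing_fun_diff: "pairing (\<lambda>i. f i - g i) v = pairing f v - pairing g v"
  and pairing_fun_add: "pairing (\<lambda>i. f i + g i) v = pairing f v + pairing g v"
  and pairing_fun_scale: "pairing (\<lambda>i. c * f i) v = c * pairing f v"
  by (simp_all add: pairing_def sum.distrib sum_subtractf sum_distrib_left distrib_left distrib_right
      left_diff_distrib right_diff_distrib mult_ac)

section \<open>Flag functionals and the Orlik--Solomon ideal\<close>

lemma ideal_os_ideal: "ideal (os_ideal H) exterior_algebra"
  unfolding os_ideal_def
  by (rule ring.genideal_ideal[OF ring_exterior_algebra]) (simp add: exterior_algebra_def)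

lemma os_relations_subset: "os_relations H \<subseteq> os_ideal H"
  unfolding os_ideal_def
  by (rule ring.genideal_self[OF ring_exterior_algebra]) (simp add: exterior_algebra_def)

lemma os_ideal_wedge_left: "y \<in> os_ideal H \<Longrightarrow> wedge a y \<in> os_ideal H"
  using ideal.I_l_closed[OF ideal_os_ideal, of y H a] by (simp add: exterior_algebra_def)

lemma os_ideal_wedge_right: "y \<in> os_ideal H \<Longrightarrow> wedge y b \<in> os_ideal H"
  using ideal.I_r_closed[OF ideal_os_ideal, of y H b] by (simp add: exterior_algebra_def)

lemma os_ideal_add: "x \<in> os_ideal H \<Longrightarrow> y \<in> os_ideal H \<Longrightarrow> x + y \<in> os_ideal H"
  using additive_subgroup.a_closed[OF ideal.axioms(1)[OF ideal_os_ideal], of x H y]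
  by (simp add: exterior_algebra_def)

lemma os_ideal_zero: "0 \<in> os_ideal H"
  using additive_subgroup.zero_closed[OF ideal.axioms(1)[OF ideal_os_ideal], of H]
  by (simp add: exterior_algebra_def)

lemma os_ideal_scale: "y \<in> os_ideal H \<Longrightarrow> c *s y \<in> os_ideal H"
  using os_ideal_wedge_left[of y H "c *s axis {} 1"] by (simp add: wedge_scale_left wedge_one_left)

lemma isotropic_iff_products_in_ideal:
  "isotropic H k V \<longleftrightarrow>
    (\<forall>vs. length vs = k \<and> set vs \<subseteq> V \<longrightarrow> foldr wedge (map ext_embed vs) (axis {} 1) \<in> os_ideal H)"
proof -
  interpret I: ideal "os_ideal H" exterior_algebra by (rule ideal_os_ideal)
  have "foldr (mult (orlik_solomon H)) (map (os_class H) vs) (one (orlik_solomon H)) =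
      a_r_coset exterior_algebra (os_ideal H) (foldr wedge (map ext_embed vs) (axis {} 1))" for vs
  proof (induction vs)
    case Nil
    then show ?case by (simp add: orlik_solomon_def FactRing_def exterior_algebra_def)
  next
    case (Cons v vs)
    then show ?case
      using I.rcoset_mult_add[of "ext_embed v" "foldr wedge (map ext_embed vs) (axis {} 1)"]
      by (simp add: orlik_solomon_def FactRing_def os_class_def) (simp add: exterior_algebra_def)
  qed
  moreover have "a_r_coset exterior_algebra (os_ideal H) y = os_ideal H \<longleftrightarrow> y \<in> os_ideal H" for y
    using I.a_rcos_self[of y] I.a_rcos_const[of y] by (auto simp: exterior_algebra_def)
  ultimately show ?thesis by (simp add: isotropic_def) (simp add: orlik_solomon_def FactRing_def)
qed

text \<open>
  The elements all of whose two-sided multiples are killed form an ideal, so only the generators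
  matter. The boundary of a non-generic family is a multiple of some \<open>x\<^sub>i - x\<^sub>j\<close> with \<open>i\<close> and
  \<open>j\<close> of equal level, and all incidence forms of the flag vanish on this vector. A family with
  empty intersection has at least \<open>n + 1\<close> members, so its monomial lies in degrees above \<open>k\<close>,
  where \<open>k\<close> contractions leave no constant term.
\<close>

lemma flag_functional_os_ideal:
  fixes H :: "'l::{finite,linorder} \<Rightarrow> (complex ^ 'd) set set"
  assumes A: "is_arrangement H" and n: "CARD('d) = n + 1" "k \<le> n"
    and F: "truncated_flag H n k S" and y: "y \<in> os_ideal H"
  shows "flag_functional H k S y = 0"
proof -
  let ?f = "flag_functional H k S"
  define Z where "Z = {z. \<forall>a b. ?f (wedge a (wedge z b)) = 0}"
  have "ideal Z exterior_algebra"
  proof (rule idealI[OF ring_exterior_algebra])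
    show "subgroup Z (add_monoid exterior_algebra)"
    proof (rule group.subgroupI)
      show "Group.group (add_monoid (exterior_algebra :: 'l ext ring))"
        by (rule abelian_group.a_group) (rule ring.is_abelian_group[OF ring_exterior_algebra])
    next
      fix z assume z: "z \<in> Z"
      have "inv\<^bsub>add_monoid exterior_algebra\<^esub> z = - z"
        using abelian_group.minus_equality[OF ring.is_abelian_group[OF ring_exterior_algebra], of "- z" z]
        unfolding a_inv_def by (simp add: exterior_algebra_def)
      then show "inv\<^bsub>add_monoid exterior_algebra\<^esub> z \<in> Z"
        using z by (simp add: Z_def wedge_minus_left wedge_minus_right flag_functional_minus)
    next
      have "0 \<in> Z" by (simp add: Z_def)
      then show "Z \<noteq> {}" by blast
    qed (auto simp: Z_def exterior_algebra_def wedge_add_left wedge_add_right flag_functional_add)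
  next
    fix a x assume a: "a \<in> Z"
    show "x \<otimes>\<^bsub>exterior_algebra\<^esub> a \<in> Z"
    proof -
      have "wedge p (wedge (wedge x a) q) = wedge (wedge p x) (wedge a q)" for p q
        by (simp add: wedge_assoc)
      then show ?thesis using a by (simp add: Z_def exterior_algebra_def)
    qed
    show "a \<otimes>\<^bsub>exterior_algebra\<^esub> x \<in> Z"
      using a by (simp add: Z_def exterior_algebra_def wedge_assoc)
  qed
  moreover have "os_relations H \<subseteq> Z"
  proof
    fix r assume "r \<in> os_relations H"
    then consider xs where "r = ext_boundary xs" "distinct xs" "codim (meet H (set xs)) < length xs"
      | xs where "r = ext_monomial xs" "distinct xs" "meet H (set xs) = {}"
      unfolding os_relations_def by blast
    then show "r \<in> Z"
    proof cases
      case (1 xs)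
      have "\<not> inj_on (flag_level H k S) (set xs)"
        using codim_of_distinct_levels[OF A F, of "set xs"] 1(2,3) by (auto simp: distinct_card)
      then obtain i j where ij: "i \<in> set xs" "j \<in> set xs" "i \<noteq> j"
        "flag_level H k S i = flag_level H k S j"
        by (auto simp: inj_on_def)
      obtain w where w: "r = wedge (ext_gen i - ext_gen j) w"
        using ext_boundary_factor[OF 1(2) ij(1-3)] 1(1) by metis
      let ?v = "axis i 1 - axis j 1"
      have null: "pairing (incidence H (S q)) ?v = 0" if "q \<in> {1..k}" for q
        using flag_subset_iff_level[OF F that] ij(4) by (simp add: pairing_diff pairing_axis incidence_def)
      have "wedge a (wedge r b) = wedge (ext_embed ?v) (wedge (grade_involution a) (wedge w b))" for a b
        unfolding w by (simp only: ext_embed_diff ext_embed_axis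
            wedge_ext_embed_right[of a ?v, unfolded ext_embed_diff ext_embed_axis] flip: wedge_assoc)
      then have "?f (wedge a (wedge r b)) = 0" for a b
        unfolding flag_functional_def
        by (simp only:) (rule iterated_contraction_wedge_null, rule null)
      then show ?thesis by (simp add: Z_def)
    next
      case (2 xs)
      have "length xs \<ge> Suc k"
        using codim_meet_le_card[OF A, of "set xs"] 2(2,3) n codim_empty[where ?'d = 'd]
        by (simp add: distinct_card)
      then have "r \<in> degree_ge (1 + k)"
        using degree_ge_ext_monomial[OF 2(2)] 2(1) by (auto simp: degree_ge_def)
      then have "iterated_contraction \<phi> k (wedge a (wedge r b)) \<in> degree_ge 1" for \<phi> a b
        by (intro degree_ge_iterated_contraction degree_ge_wedge_left degree_ge_wedge_right)
      then show ?thesis by (simp add: Z_def flag_functional_def degree_ge_def)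
    qed
  qed
  ultimately have "os_ideal H \<subseteq> Z"
    unfolding os_ideal_def by (rule ring.genideal_minimal[OF ring_exterior_algebra])
  then have "?f (wedge (axis {} 1) (wedge y (axis {} 1))) = 0" using y by (auto simp: Z_def)
  then show ?thesis by (simp add: wedge_one_left wedge_one_right)
qed

section \<open>Reduction to monomials without broken circuits\<close>

definition nbc_reducible :: "('l::{finite,linorder} \<Rightarrow> (complex ^ 'd) set set) \<Rightarrow> nat \<Rightarrow> 'l ext \<Rightarrow> bool" where
  "nbc_reducible H k y \<longleftrightarrow>
     (\<exists>z. y - z \<in> os_ideal H \<and> (\<forall>J. z $ J \<noteq> 0 \<longrightarrow> card J = k \<and> nbc H J))"

lemma nbc_reducible_ideal: "y \<in> os_ideal H \<Longrightarrow> nbc_reducible H k y"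
  unfolding nbc_reducible_def by (intro exI[of _ 0]) simp

lemma nbc_reducible_add:
  assumes "nbc_reducible H k x" "nbc_reducible H k y"
  shows "nbc_reducible H k (x + y)"
proof -
  obtain u where u: "x - u \<in> os_ideal H" "\<And>J. u $ J \<noteq> 0 \<Longrightarrow> card J = k \<and> nbc H J"
    using assms(1) unfolding nbc_reducible_def by blast
  obtain v where v: "y - v \<in> os_ideal H" "\<And>J. v $ J \<noteq> 0 \<Longrightarrow> card J = k \<and> nbc H J"
    using assms(2) unfolding nbc_reducible_def by blast
  have "(x + y) - (u + v) = (x - u) + (y - v)" by simp
  then have "(x + y) - (u + v) \<in> os_ideal H" using os_ideal_add[OF u(1) v(1)] by (simp only:)
  moreover have "card J = k \<and> nbc H J" if "(u + v) $ J \<noteq> 0" for J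
  proof -
    have "u $ J \<noteq> 0 \<or> v $ J \<noteq> 0" using that by auto
    then show ?thesis using u(2) v(2) by blast
  qed
  ultimately show ?thesis unfolding nbc_reducible_def by blast
qed

lemma nbc_reducible_scale:
  assumes "nbc_reducible H k y"
  shows "nbc_reducible H k (c *s y)"
proof -
  obtain v where v: "y - v \<in> os_ideal H" "\<And>J. v $ J \<noteq> 0 \<Longrightarrow> card J = k \<and> nbc H J"
    using assms unfolding nbc_reducible_def by blast
  have "c *s y - c *s v \<in> os_ideal H"
    using os_ideal_scale[OF v(1), of c] by (simp add: vector_ssub_ldistrib)
  moreover have "card J = k \<and> nbc H J" if "(c *s v) $ J \<noteq> 0" for J
  proof -
    have "v $ J \<noteq> 0" using that by auto
    then show ?thesis by (rule v(2))
  qed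
  ultimately show ?thesis unfolding nbc_reducible_def by blast
qed

lemma nbc_reducible_sum:
  "(\<And>i. i \<in> I \<Longrightarrow> nbc_reducible H k (f i)) \<Longrightarrow> nbc_reducible H k (\<Sum>i\<in>I. f i)"
  by (induction I rule: infinite_finite_induct)
    (simp_all add: nbc_reducible_add nbc_reducible_ideal os_ideal_zero)

lemma nbc_reducible_ext_monomial:
  assumes "distinct xs" "nbc_reducible H k (axis (set xs) 1)"
  shows "nbc_reducible H k (ext_monomial xs)"
  using ext_monomial_distinct[OF assms(1)] nbc_reducible_scale[OF assms(2)] by metis

lemma nbc_reducible_axis_of_ext_monomial:
  assumes "distinct xs" "nbc_reducible H k (ext_monomial xs)"
  shows "nbc_reducible H k (axis (set xs) 1)"
  using axis_eq_ext_monomial[OF assms(1)] nbc_reducible_scale[OF assms(2)] by metis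

text \<open>
  If \<open>T\<close> contains \<open>B\<close> and \<open>m\<close> lies below \<open>B\<close> with \<open>{m} \<union> B\<close> dependent, then the
  relation for \<open>{m} \<union> B\<close> expresses \<open>x\<^sub>B\<close> by the monomials in which some \<open>b \<in> B\<close> is replaced by
  the smaller \<open>m\<close>. Each replacement decreases the sum of the positions of the indices, so the
  process ends. If \<open>m\<close> already belongs to \<open>T\<close>, multiplying the relation by \<open>x\<^sub>m\<close> puts the
  monomial into the ideal. The bound on \<open>k\<close> ensures that the dependent hyperplanes meet in
  projective space, so that their boundary is indeed one of the relations.
\<close>

lemma nbc_reducible_axis:
  fixes H :: "'l::{finite,linorder} \<Rightarrow> (complex ^ 'd) set set"
  assumes A: "is_arrangement H" and k: "k < CARD('d)" and "card T = k"
  shows "nbc_reducible H k (axis T 1)"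
  using assms(3)
proof (induction "\<Sum>t\<in>T. card {..<t}" arbitrary: T rule: less_induct)
  case less
  show ?case
  proof (cases "nbc H T")
    case True
    then show ?thesis
      unfolding nbc_reducible_def using less.prems os_ideal_zero[of H]
      by (intro exI[of _ "axis T 1"]) (auto simp: axis_def)
  next
    case False
    then obtain m B where B: "B \<subseteq> T" and m: "\<And>b. b \<in> B \<Longrightarrow> m < b"
      and dep: "codim (meet H (insert m B)) \<noteq> Suc (card B)"
      unfolding nbc_def by blast
    have mB: "m \<notin> B" using m by blast
    have lt: "codim (meet H (insert m B)) < Suc (card B)"
      using codim_meet_le_card[OF A, of "insert m B"] dep mB by simp
    have "card B \<le> k" using card_mono[OF _ B] less.prems by simp
    then have ne: "meet H (insert m B) \<noteq> {}"
      using lt k codim_empty[where ?'d = 'd] by force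
    define ys where "ys = sorted_list_of_set B"
    have ys: "set ys = B" "distinct ys" "length ys = card B" by (simp_all add: ys_def)
    have "ext_boundary (m # ys) \<in> os_relations H"
      unfolding os_relations_def using ys mB ne lt
      by (intro UnI1 CollectI exI[of _ "m # ys"]) simp
    then have "(-1) *s ext_boundary (m # ys) \<in> os_ideal H"
      using os_relations_subset os_ideal_scale by blast
    moreover have "(-1) *s ext_boundary (m # ys) =
        ext_monomial ys - wedge (ext_gen m) (contract (\<lambda>_. 1) (ext_monomial ys))"
      by (simp add: ext_boundary_eq_contract ext_monomial_Cons contract_wedge_ext_gen)
    ultimately have rel: "ext_monomial ys - wedge (ext_gen m) (contract (\<lambda>_. 1) (ext_monomial ys)) \<in> os_ideal H"
      by simp
    show ?thesis
    proof (cases "m \<in> T")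
      case True
      define zs where "zs = sorted_list_of_set (T - insert m B)"
      have zs: "set zs = T - insert m B" "distinct zs" by (simp_all add: zs_def)
      have "wedge (wedge (ext_gen m) (ext_monomial ys - wedge (ext_gen m) (contract (\<lambda>_. 1) (ext_monomial ys))))
          (ext_monomial zs) = ext_monomial (m # ys @ zs)"
        by (simp add: wedge_diff_right wedge_ext_gen_self ext_monomial_Cons ext_monomial_append
            flip: wedge_assoc)
      moreover have "wedge (wedge (ext_gen m) (ext_monomial ys - wedge (ext_gen m) (contract (\<lambda>_. 1) (ext_monomial ys))))
          (ext_monomial zs) \<in> os_ideal H"
        by (intro os_ideal_wedge_right os_ideal_wedge_left rel)
      ultimately have "nbc_reducible H k (ext_monomial (m # ys @ zs))"
        by (intro nbc_reducible_ideal) simp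
      moreover have "set (m # ys @ zs) = T" using ys zs True B by auto
      moreover have "distinct (m # ys @ zs)" using ys zs mB by auto
      ultimately show ?thesis using nbc_reducible_axis_of_ext_monomial by metis
    next
      case mT: False
      define zs where "zs = sorted_list_of_set (T - B)"
      have zs: "set zs = T - B" "distinct zs" by (simp_all add: zs_def)
      let ?del = "\<lambda>j. m # take j ys @ drop (Suc j) ys @ zs"
      have "nbc_reducible H k (ext_monomial (?del j))" if j: "j < length ys" for j
      proof (rule nbc_reducible_ext_monomial)
        have split: "ys = take j ys @ ys ! j # drop (Suc j) ys" by (rule id_take_nth_drop[OF j])
        then have d: "distinct (take j ys @ ys ! j # drop (Suc j) ys)" using ys(2) by simp
        have b: "ys ! j \<in> B" using j ys(1) nth_mem by blast
        have sB: "insert (ys ! j) (set (take j ys) \<union> set (drop (Suc j) ys)) = B"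
          using arg_cong[OF split, of set] ys(1) by simp
        have nb: "ys ! j \<notin> set (take j ys) \<union> set (drop (Suc j) ys)" using d by auto
        have sT: "set (?del j) = insert m (T - {ys ! j})"
          using sB nb zs(1) B by auto
        show "distinct (?del j)" using d zs sB mT B by auto
        have "(\<Sum>t\<in>insert m (T - {ys ! j}). card {..<t}) = card {..<m} + (\<Sum>t\<in>T - {ys ! j}. card {..<t})"
          using mT by simp
        also have "\<dots> < card {..<ys ! j} + (\<Sum>t\<in>T - {ys ! j}. card {..<t})"
          using m[OF b] by (intro add_strict_right_mono psubset_card_mono) auto
        also have "\<dots> = (\<Sum>t\<in>T. card {..<t})"
          using b B by (subst sum.remove[of T "ys ! j"]) auto
        finally show "nbc_reducible H k (axis (set (?del j)) 1)"
          unfolding sT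
        proof (rule less.hyps)
          have "ys ! j \<in> T" using b B by auto
          then show "card (insert m (T - {ys ! j})) = k"
            using mT less.prems card_Suc_Diff1[of T "ys ! j"] by simp
        qed
      qed
      then have "nbc_reducible H k (\<Sum>j<length ys. (-1) ^ j *s ext_monomial (?del j))"
        by (intro nbc_reducible_sum nbc_reducible_scale) simp
      moreover have "wedge (wedge (ext_gen m) (contract (\<lambda>_. 1) (ext_monomial ys))) (ext_monomial zs) =
          (\<Sum>j<length ys. (-1) ^ j *s ext_monomial (?del j))"
        by (simp add: contract_ext_monomial wedge_sum_left wedge_sum_right wedge_scale_left
            wedge_scale_right ext_monomial_Cons ext_monomial_append wedge_assoc)
      moreover have "nbc_reducible H k (wedge (ext_monomial ys -
          wedge (ext_gen m) (contract (\<lambda>_. 1) (ext_monomial ys))) (ext_monomial zs))"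
        by (intro nbc_reducible_ideal os_ideal_wedge_right rel)
      ultimately have "nbc_reducible H k (ext_monomial (ys @ zs))"
        using nbc_reducible_add by (fastforce simp: wedge_diff_left ext_monomial_append)
      moreover have "set (ys @ zs) = T" "distinct (ys @ zs)" using ys zs B by auto
      ultimately show ?thesis using nbc_reducible_axis_of_ext_monomial by metis
    qed
  qed
qed

text \<open>
  Monomials without broken circuits and the flags attached to them are dual up to sign. On the
  diagonal, the incidence forms of the flag of \<open>I\<close> take triangular values at the generators of
  \<open>I\<close>. Off the diagonal, \<open>J\<close> has an element of level \<open>0\<close> or two elements of equal level;
  either way its monomial has a vector factor on which all the forms vanish.
\<close>

lemma flag_functional_nbc_axis:
  fixes H :: "'l::{finite,linorder} \<Rightarrow> (complex ^ 'd) set set"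
  assumes A: "is_arrangement H" and n: "CARD('d) = n + 1"
    and I: "nbc H I" "card I \<le> n" and J: "nbc H J" "card J = card I"
  shows "flag_functional H (card I) (nbc_flag H I) (axis J 1) \<noteq> 0 \<longleftrightarrow> J = I"
proof (cases "J = I")
  case True
  let ?k = "card I" and ?xs = "sorted_list_of_set I"
  define \<alpha> where "\<alpha> p = axis (?xs ! (p - 1)) (1 :: complex)" for p
  \<comment> \<open>The factors appear in decreasing order: \<open>i\<^sub>k\<close> is met first, by the form of the
    hyperplane \<open>H\<^sub>i\<^sub>k\<close>, which vanishes at all smaller elements of \<open>I\<close>.\<close>
  have "map \<alpha> [1..<Suc ?k] = map (\<lambda>i. axis i 1) ?xs"
    by (rule nth_equalityI) (simp_all add: \<alpha>_def del: upt_Suc)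
  then have "foldr wedge (map ext_embed (rev (map \<alpha> [1..<Suc ?k]))) (axis {} 1) = ext_monomial (rev ?xs)"
    by (simp add: ext_monomial_def ext_embed_axis comp_def rev_map del: upt_Suc)
  moreover have "iterated_contraction (\<lambda>q. incidence H (nbc_flag H I q)) ?k
      (foldr wedge (map ext_embed (rev (map \<alpha> [1..<Suc ?k]))) (axis {} 1)) = axis {} 1"
    by (rule iterated_contraction_dual_product)
      (auto simp: \<alpha>_def pairing_axis incidence_def nbc_flag_subset_nth[simplified]
        nbc_flag_not_subset_nth[OF A I(1), simplified])
  ultimately have "flag_functional H ?k (nbc_flag H I) (ext_monomial (rev ?xs)) = 1"
    by (simp add: flag_functional_def)
  moreover obtain c where "c = 1 \<or> c = -1" "axis (set (rev ?xs)) 1 = c *s ext_monomial (rev ?xs)"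
    using axis_eq_ext_monomial[of "rev ?xs"] by auto
  ultimately show ?thesis using True by (auto simp: flag_functional_scale)
next
  case False
  let ?k = "card I" and ?S = "nbc_flag H I"
  let ?l = "flag_level H ?k ?S"
  have F: "truncated_flag H n ?k ?S" by (rule nbc_flag_truncated[OF A n I])
  have "\<not> inj_on ?l J \<or> (\<exists>j\<in>J. ?l j = 0)"
  proof (rule ccontr)
    assume "\<not> ?thesis"
    then have "J = I" by (intro nbc_flag_determines[OF A n I J]) simp_all
    with False show False ..
  qed
  then obtain v w where vw: "axis J 1 = wedge (ext_embed v) w"
    and null: "\<And>q. q \<in> {1..?k} \<Longrightarrow> pairing (incidence H (?S q)) v = 0"
  proof (elim disjE)
    assume "\<not> inj_on ?l J"
    then obtain i j where ij: "i \<in> J" "j \<in> J" "i \<noteq> j" "?l i = ?l j" by (auto simp: inj_on_def)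
    let ?m = "ext_monomial (sorted_list_of_set (J - {i, j}))"
    have "set (i # j # sorted_list_of_set (J - {i, j})) = J" using ij by auto
    moreover have "distinct (i # j # sorted_list_of_set (J - {i, j}))" using ij(3) by simp
    ultimately obtain c where "axis J 1 = c *s ext_monomial (i # j # sorted_list_of_set (J - {i, j}))"
      using axis_eq_ext_monomial by metis
    then have "axis J 1 = wedge (ext_embed (axis i 1 - axis j 1)) (c *s wedge (ext_gen j) ?m)"
      by (simp add: ext_embed_diff ext_embed_axis ext_monomial_Cons wedge_scale_right wedge_diff_left
          wedge_ext_gen_self flip: wedge_assoc)
    moreover have "pairing (incidence H (?S q)) (axis i 1 - axis j 1) = 0" if "q \<in> {1..?k}" for q
      using flag_subset_iff_level[OF F that] ij(4) by (simp add: pairing_diff pairing_axis incidence_def)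
    ultimately show ?thesis by (rule that)
  next
    assume "\<exists>j\<in>J. ?l j = 0"
    then obtain j where j: "j \<in> J" "?l j = 0" by blast
    have "set (j # sorted_list_of_set (J - {j})) = J" using j by auto
    moreover have "distinct (j # sorted_list_of_set (J - {j}))" by simp
    ultimately obtain c where "axis J 1 = c *s ext_monomial (j # sorted_list_of_set (J - {j}))"
      using axis_eq_ext_monomial by metis
    then have "axis J 1 = wedge (ext_embed (axis j 1)) (c *s ext_monomial (sorted_list_of_set (J - {j})))"
      by (simp add: ext_embed_axis ext_monomial_Cons wedge_scale_right)
    moreover have "pairing (incidence H (?S q)) (axis j 1) = 0" if "q \<in> {1..?k}" for q
      using flag_subset_iff_level[OF F that, of j] j(2) that by (simp add: pairing_axis incidence_def)
    ultimately show ?thesis by (rule that)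
  qed
  then show ?thesis
    using iterated_contraction_wedge_null[of ?k "\<lambda>q. incidence H (?S q)" v w] False
    by (simp add: flag_functional_def)
qed

text \<open>
  Nondegeneracy of the pairing between degree \<open>k\<close> and flags of length \<open>k\<close>: modulo the ideal the
  element is a combination of monomials without broken circuits, and the duality reads off each
  coefficient as the value of a flag functional.
\<close>

lemma mem_os_ideal_if_flag_functionals_vanish:
  fixes H :: "'l::{finite,linorder} \<Rightarrow> (complex ^ 'd) set set"
  assumes A: "is_arrangement H" and n: "CARD('d) = n + 1" "k \<le> n"
    and hom: "\<And>T. card T \<noteq> k \<Longrightarrow> y $ T = 0"
    and van: "\<And>S. truncated_flag H n k S \<Longrightarrow> flag_functional H k S y = 0"
  shows "y \<in> os_ideal H"
proof -
  have "nbc_reducible H k (y $ T *s axis T 1)" for T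
  proof (cases "card T = k")
    case True
    then show ?thesis using n by (intro nbc_reducible_scale nbc_reducible_axis[OF A]) auto
  next
    case False
    then show ?thesis using hom by (simp add: nbc_reducible_ideal os_ideal_zero)
  qed
  then have "nbc_reducible H k (\<Sum>T\<in>UNIV. y $ T *s axis T 1)" by (intro nbc_reducible_sum)
  then obtain z where z: "y - z \<in> os_ideal H" "\<And>J. z $ J \<noteq> 0 \<Longrightarrow> card J = k \<and> nbc H J"
    unfolding nbc_reducible_def by (auto simp: basis_expansion)
  have "z $ I = 0" for I
  proof (rule ccontr)
    assume nz: "z $ I \<noteq> 0"
    then have I: "card I = k" "nbc H I" using z(2) by auto
    let ?f = "flag_functional H (card I) (nbc_flag H I)"
    have F: "truncated_flag H n k (nbc_flag H I)"
      using nbc_flag_truncated[OF A n(1) I(2)] I(1) n(2) by simp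
    have "?f y = 0" using van[OF F] I(1) by simp
    moreover have "?f (y - z) = 0" using flag_functional_os_ideal[OF A n F z(1)] I(1) by simp
    ultimately have "?f z = 0"
      using flag_functional_add[of H "card I" "nbc_flag H I" "y - z" z] by simp
    moreover have "?f z = z $ I * ?f (axis I 1)"
    proof -
      have "?f z = (\<Sum>J\<in>UNIV. z $ J * ?f (axis J 1))"
        by (subst ext_eq_sum_axis[of z]) (simp only: flag_functional_sum flag_functional_scale)
      also have "\<dots> = (\<Sum>J\<in>UNIV. if J = I then z $ I * ?f (axis I 1) else 0)"
      proof (rule sum.cong)
        fix J
        show "z $ J * ?f (axis J 1) = (if J = I then z $ I * ?f (axis I 1) else 0)"
          using flag_functional_nbc_axis[OF A n(1) I(2), of J] I(1) n(2) z(2)[of J]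
          by (cases "z $ J = 0") auto
      qed simp
      finally show ?thesis by simp
    qed
    ultimately show False
      using nz flag_functional_nbc_axis[OF A n(1) I(2) _ I(2)] I(1) n(2) by simp
  qed
  then have "z = 0" by (simp add: vec_eq_iff)
  then show ?thesis using z(1) by simp
qed

section \<open>Rank of the flat vectors\<close>

lemma separating_functional:
  fixes A :: "(complex ^ 'r) set"
  assumes "x \<notin> vec.span A"
  obtains c :: "complex ^ 'r" where "(\<Sum>r\<in>UNIV. c $ r * x $ r) = 1"
    "\<And>a. a \<in> A \<Longrightarrow> (\<Sum>r\<in>UNIV. c $ r * a $ r) = 0"
proof -
  obtain B where B: "B \<subseteq> A" "vec.independent B" "A \<subseteq> vec.span B"
    using vec.maximal_independent_subset[of A] by blast
  have xB: "x \<notin> vec.span B" using assms vec.span_mono[OF B(1)] by blast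
  then have "vec.independent (insert x B)" using B(2) by (simp add: vec.independent_insertI)
  then obtain g :: "complex ^ 'r \<Rightarrow> complex ^ 'r" where g: "Vector_Spaces.linear (*s) (*s) g"
    "\<forall>b\<in>insert x B. g b = (if b = x then (\<chi> i. 1) else 0)"
    using vec.linear_independent_extend[of "insert x B" "\<lambda>b. if b = x then (\<chi> i. 1) else 0"] by blast
  define c :: "complex ^ 'r" where "c = (\<chi> r. g (axis r 1) $ undefined)"
  have gc: "(\<Sum>r\<in>UNIV. c $ r * a $ r) = g a $ undefined" for a
    using linear_componentwise[OF g(1), of a undefined] by (simp add: c_def mult.commute)
  have "g b = 0" if "b \<in> B" for b using g(2) that xB vec.span_base[of b B] by auto
  then have "g a = 0" if "a \<in> A" for a
    using vec.linear_eq_0_on_span[OF g(1), of B] that B(3) by blast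
  then show ?thesis using g(2) by (intro that[of c]) (simp_all add: gc)
qed

lemma dim_image_lt_if_dependent:
  fixes v :: "nat \<Rightarrow> complex ^ 'r"
  assumes "t \<in> {1..k}" "v t \<in> vec.span (v ` ({1..k} - {t}))"
  shows "vec.dim (v ` {1..k}) < k"
proof -
  have "v ` {1..k} = insert (v t) (v ` ({1..k} - {t}))" using assms(1) by blast
  then have "vec.dim (v ` {1..k}) = vec.dim (v ` ({1..k} - {t}))"
    using assms(2) by (simp add: vec.dim_insert)
  also have "\<dots> \<le> card (v ` ({1..k} - {t}))" by (rule vec.dim_le_card'[OF finite_imageI]) simp
  also have "\<dots> \<le> card ({1..k} - {t})" by (rule card_image_le) simp
  also have "\<dots> < k" using assms(1) by simp
  finally show ?thesis .
qed

lemma dim_image_eq_if_independent: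
  fixes v :: "nat \<Rightarrow> complex ^ 'r"
  assumes "\<And>t. t \<in> {1..k} \<Longrightarrow> v t \<notin> vec.span (v ` {1..<t})"
  shows "vec.dim (v ` {1..k}) = k"
  using assms
proof (induction k)
  case (Suc k)
  have "v ` {1..Suc k} = insert (v (Suc k)) (v ` {1..k})"
    by (simp add: atLeastAtMostSuc_conv)
  moreover have "v (Suc k) \<notin> vec.span (v ` {1..k})"
    using Suc.prems[of "Suc k"] by (simp add: atLeastLessThanSuc_atLeastAtMost)
  ultimately show ?case using Suc by (simp add: vec.dim_insert)
qed simp

lemma pairing_incidence_row:
  "pairing (incidence H S) (row r M) = flat_vector H M S $ r"
  by (simp add: pairing_def incidence_def flat_vector_def row_def column_def sum.If_cases
      if_distrib[of "\<lambda>c. c * _"] Collect_neg_eq cong: if_cong)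

lemma subspace_pairing_null: "vec.subspace {v. pairing f v = 0}"
  by (rule vec.subspaceI) (simp_all add: pairing_add pairing_scale, simp add: pairing_def)

lemma pairing_null_on_row_span:
  assumes "\<And>r. pairing f (row r M) = 0" "v \<in> vec.span (rows M)"
  shows "pairing f v = 0"
proof -
  have "vec.span (rows M) \<subseteq> {v. pairing f v = 0}"
    using assms(1) by (intro vec.span_minimal subspace_pairing_null) (auto simp: rows_def)
  then show ?thesis using assms(2) by blast
qed

text \<open>
  A relation \<open>v\<^sub>t = \<Sum>\<^bsub>s < t\<^esub> c\<^sub>s v\<^sub>s\<close> between the flat vectors says that, on the row space of \<open>M\<close>, the
  incidence form of the \<open>t\<close>-th flag member agrees with the combination \<open>f = \<Sum>\<^bsub>s < t\<^esub> c\<^sub>s \<phi>\<^sub>s\<close>. The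
  forms \<open>\<phi>\<^sub>s\<close> with \<open>s < t\<close> are contracted again after \<open>\<phi>\<^sub>t\<close>, and a repeated contraction is zero.
\<close>

lemma flag_functional_product_dependent:
  fixes M :: "complex ^ 'l::{finite,linorder} ^ 'r"
  assumes lt: "vec.dim ((\<lambda>i. flat_vector H M (S i)) ` {1..k}) < k"
    and vs: "set vs \<subseteq> vec.span (rows M)"
  shows "flag_functional H k S (foldr wedge (map ext_embed vs) (axis {} 1)) = 0"
proof -
  let ?v = "\<lambda>i. flat_vector H M (S i)" and ?\<phi> = "\<lambda>q. incidence H (S q)"
  obtain t where t: "t \<in> {1..k}" "?v t \<in> vec.span (?v ` {1..<t})"
    using dim_image_eq_if_independent[of k ?v] lt by (metis less_irrefl)
  define m where "m = t - 1"
  \<comment> \<open>The coefficients \<open>c\<^sub>s\<close> need not be named: the vectors \<open>w\<close> for which a suitable form exists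
    make up a subspace.\<close>
  define Q where "Q = {w. \<exists>f. (\<forall>r. pairing f (row r M) = w $ r) \<and>
    (\<forall>z. iterated_contraction ?\<phi> m (contract f z) = 0)}"
  have "vec.subspace Q"
  proof (rule vec.subspaceI)
    have "contract (\<lambda>_. 0) z = 0" for z :: "'l ext" by (simp add: contract_def vec_eq_iff)
    then show "0 \<in> Q" unfolding Q_def by (intro CollectI exI[of _ "\<lambda>_. 0"]) (simp add: pairing_def)
  next
    fix u w assume "u \<in> Q" "w \<in> Q"
    then obtain f g where
      f: "\<And>r. pairing f (row r M) = u $ r" "\<And>z. iterated_contraction ?\<phi> m (contract f z) = 0" and
      g: "\<And>r. pairing g (row r M) = w $ r" "\<And>z. iterated_contraction ?\<phi> m (contract g z) = 0"
      unfolding Q_def by blast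
    show "u + w \<in> Q" unfolding Q_def
      by (intro CollectI exI[of _ "\<lambda>i. f i + g i"])
        (simp add: f g pairing_fun_add contract_add_fun iterated_contraction_add)
  next
    fix c u assume "u \<in> Q"
    then obtain f where
      f: "\<And>r. pairing f (row r M) = u $ r" "\<And>z. iterated_contraction ?\<phi> m (contract f z) = 0"
      unfolding Q_def by blast
    show "c *s u \<in> Q" unfolding Q_def
      by (intro CollectI exI[of _ "\<lambda>i. c * f i"])
        (simp add: f pairing_fun_scale contract_scale_fun iterated_contraction_scale)
  qed
  moreover have "?v ` {1..<t} \<subseteq> Q"
  proof
    fix w assume "w \<in> ?v ` {1..<t}"
    then obtain s where "s \<in> {1..<t}" "w = ?v s" by blast
    then have s: "s \<in> {1..m}" "w = ?v s" by (auto simp: m_def)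
    then show "w \<in> Q" unfolding Q_def
      by (intro CollectI exI[of _ "?\<phi> s"])
        (simp add: pairing_incidence_row iterated_contraction_contract[of s m ?\<phi>])
  qed
  ultimately have "?v t \<in> Q" using t(2) vec.span_minimal by blast
  then obtain f where f: "\<And>r. pairing f (row r M) = ?v t $ r"
    "\<And>z. iterated_contraction ?\<phi> m (contract f z) = 0"
    unfolding Q_def by blast
  have "pairing (\<lambda>i. ?\<phi> t i - f i) v = 0" if "v \<in> set vs" for v
  proof (rule pairing_null_on_row_span)
    show "pairing (\<lambda>i. ?\<phi> t i - f i) (row r M) = 0" for r
      by (simp only: pairing_fun_diff pairing_incidence_row f(1)) simp
    show "v \<in> vec.span (rows M)" using that vs by blast
  qed
  then have "contract (\<lambda>i. ?\<phi> t i - f i) (foldr wedge (map ext_embed vs) (axis {} 1)) = 0"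
    by (rule contract_null_product)
  then show ?thesis
    unfolding flag_functional_def using f(2)[unfolded m_def]
    by (subst iterated_contraction_dependent[OF t(1), of ?\<phi> f]) simp_all
qed

text \<open>
  Linear forms on the column space are evaluated against flat vectors exactly as incidence forms
  against combinations of rows. So a flat vector outside the span of others yields a vector of the
  row space on which its incidence form is \<open>1\<close> and those of the others vanish.
\<close>

lemma dual_vectors_in_row_span:
  fixes M :: "complex ^ 'l::{finite,linorder} ^ 'r"
  assumes "flat_vector H M S \<notin> vec.span (flat_vector H M ` A)"
  obtains \<alpha> where "\<alpha> \<in> vec.span (rows M)" "pairing (incidence H S) \<alpha> = 1"
    "\<And>T. T \<in> A \<Longrightarrow> pairing (incidence H T) \<alpha> = 0"
proof -
  obtain c where c: "(\<Sum>r\<in>UNIV. c $ r * flat_vector H M S $ r) = 1"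
    "\<And>a. a \<in> flat_vector H M ` A \<Longrightarrow> (\<Sum>r\<in>UNIV. c $ r * a $ r) = 0"
    using separating_functional[OF assms] by blast
  define \<alpha> where "\<alpha> = (\<Sum>r\<in>UNIV. c $ r *s row r M)"
  have "pairing f (\<Sum>r\<in>R. c $ r *s row r M) = (\<Sum>r\<in>R. c $ r * pairing f (row r M))" for f R
    by (induction R rule: infinite_finite_induct) (simp_all add: pairing_add pairing_scale, simp_all add: pairing_def)
  then have "pairing (incidence H T) \<alpha> = (\<Sum>r\<in>UNIV. c $ r * flat_vector H M T $ r)" for T
    by (simp add: \<alpha>_def pairing_incidence_row)
  moreover have "\<alpha> \<in> vec.span (rows M)"
    unfolding \<alpha>_def by (intro vec.span_sum vec.span_scale vec.span_base) (auto simp: rows_def)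
  ultimately show ?thesis using c by (intro that) auto
qed

section \<open>The isotropy criterion\<close>

theorem lemma9:
  fixes H :: "'l::{finite,linorder} \<Rightarrow> (complex ^ 'd) set set"
    and n k :: nat
    and V :: "(complex ^ ('l::{finite,linorder})) set"
    and M :: "complex ^ ('l::{finite,linorder}) ^ 'r"
  assumes "CARD('d) = n + 1"
    and "is_arrangement H"
    and "1 \<le> k" and "k \<le> n"
    and "vec.subspace V"
    and "vec.span (rows M) = V"
  shows "isotropic H k V \<longleftrightarrow>
    (\<forall>S. truncated_flag H n k S \<longrightarrow>
       vec.dim (vec.span ((\<lambda>i. flat_vector H M (S i)) ` {1..k})) < k)"
proof (intro iffI allI impI)
  fix S assume iso: "isotropic H k V" and F: "truncated_flag H n k S"
  let ?v = "\<lambda>i. flat_vector H M (S i)"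
  show "vec.dim (vec.span (?v ` {1..k})) < k"
  proof (rule ccontr)
    assume "\<not> ?thesis"
    then have indep: "?v t \<notin> vec.span (flat_vector H M ` S ` ({1..k} - {t}))" if "t \<in> {1..k}" for t
      using dim_image_lt_if_dependent[OF that, of ?v] by (auto simp: image_image)
    have "\<forall>t\<in>{1..k}. \<exists>\<alpha>\<in>V. pairing (incidence H (S t)) \<alpha> = 1 \<and>
        (\<forall>s\<in>{1..k} - {t}. pairing (incidence H (S s)) \<alpha> = 0)"
    proof
      fix t assume "t \<in> {1..k}"
      from dual_vectors_in_row_span[OF indep[OF this]] obtain \<alpha> where
        "\<alpha> \<in> vec.span (rows M)" "pairing (incidence H (S t)) \<alpha> = 1"
        "\<And>T. T \<in> S ` ({1..k} - {t}) \<Longrightarrow> pairing (incidence H T) \<alpha> = 0"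
        by blast
      then show "\<exists>\<alpha>\<in>V. pairing (incidence H (S t)) \<alpha> = 1 \<and>
        (\<forall>s\<in>{1..k} - {t}. pairing (incidence H (S s)) \<alpha> = 0)"
        using assms(6) by blast
    qed
    then obtain \<alpha> where \<alpha>: "\<And>t. t \<in> {1..k} \<Longrightarrow> \<alpha> t \<in> V \<and> pairing (incidence H (S t)) (\<alpha> t) = 1 \<and>
        (\<forall>s\<in>{1..k} - {t}. pairing (incidence H (S s)) (\<alpha> t) = 0)"
      by metis
    let ?vs = "rev (map \<alpha> [1..<Suc k])"
    have "foldr wedge (map ext_embed ?vs) (axis {} 1) \<in> os_ideal H"
    proof -
      have "set ?vs \<subseteq> V" using \<alpha> by (auto simp del: upt_Suc)
      moreover have "length ?vs = k" by (simp del: upt_Suc)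
      ultimately show ?thesis using iso unfolding isotropic_iff_products_in_ideal by blast
    qed
    then have "flag_functional H k S (foldr wedge (map ext_embed ?vs) (axis {} 1)) = 0"
      by (rule flag_functional_os_ideal[OF assms(2,1,4) F])
    moreover have "iterated_contraction (\<lambda>q. incidence H (S q)) k
        (foldr wedge (map ext_embed ?vs) (axis {} 1)) = axis {} 1"
      using \<alpha> by (intro iterated_contraction_dual_product) auto
    ultimately show False by (simp only: flag_functional_def) (simp add: axis_def)
  qed
next
  assume flags: "\<forall>S. truncated_flag H n k S \<longrightarrow>
       vec.dim (vec.span ((\<lambda>i. flat_vector H M (S i)) ` {1..k})) < k"
  show "isotropic H k V"
    unfolding isotropic_iff_products_in_ideal
  proof (intro allI impI, elim conjE)
    fix vs assume vs: "length vs = k" "set vs \<subseteq> V"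
    show "foldr wedge (map ext_embed vs) (axis {} 1) \<in> os_ideal H"
    proof (rule mem_os_ideal_if_flag_functionals_vanish[OF assms(2,1,4)])
      fix T :: "'l set" assume "card T \<noteq> k"
      then show "foldr wedge (map ext_embed vs) (axis {} 1) $ T = 0"
        using vs(1) by (intro product_homogeneous) simp
    next
      fix S assume "truncated_flag H n k S"
      then show "flag_functional H k S (foldr wedge (map ext_embed vs) (axis {} 1)) = 0"
        using flags vs(2) assms(6) by (intro flag_functional_product_dependent[of H M]) auto
    qed
  qed
qed

end
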